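(* Let $n\ge 4$, and set $k=\lfloor n/2\rfloor$, $\ell=\lceil n/2\rceil$. For $Y=(y_{i,j})\in\mathbb R^{C}$ write $$R_{i,j}(Y)=\sum_{j'=1}^{\min\{\ell,j\}}y_{i,j'}+\sum_{j'=\ell+1}^{j}y_{n+1-i,\,n+1-j'}\quad(i\in[k],\ j\in[n-1]),\qquad K_{i,j}(Y)=\sum_{i'=1}^{i}y_{i',j}\quad(i\in[n-1],\ j\in[k]),$$ and, if $n$ is odd, $M_j(Y)=\sum_{j'=1}^{j}y_{\ell,j'}$ for $j\in[k]$ and $N_i(Y)=\sum_{i'=1}^{i}y_{i',\ell}$ for $i\in[k]$. The facets of $P^{\mathrm{core}}_{\mathrm{HTSASM}}$ are exactly the following faces of $P^{\mathrm{core}}_{\mathrm{HTSASM}}$, one for each listed equation: (a) $\{R_{i,j}(Y)=0\}$ for $(i,j)\in\{(1,1)\}\cup([2,k]\times[n-2])$; (b) $\{R_{i,j}(Y)=1\}$ for $(i,j)\in\{(1,n-1)\}\cup([2,k]\times[2,n-1])$; (c) $\{K_{i,j}(Y)=0\}$ for $(i,j)\in[n-2]\times[2,k]$; (d) $\{K_{i,j}(Y)=1\}$ for $(i,j)\in[2,n-1]\times[2,k]$; and, only if $n$ is odd, additionally: (e) $\{M_j(Y)=0\}$ for $j\in[k]$ and $\{M_j(Y)=1\}$ for $j\in[2,k]$; (f) $\{N_i(Y)=0\}$ for $i\in[k-1]$ and $\{N_i(Y)=1\}$ for $i\in[2,k-1]$. In particular, the number of facets of $P^{\mathrm{core}}_{\mathrm{HTSASM}}$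 is $2\bigl((n-2)^2+\chi_{2\mid n}\bigr)$.
   Context: $[a,b]=\{a,a+1,\dots,b\}$ for integers $a\le b$, $[a,b]=\emptyset$ if $a>b$, and $[n]=[1,n]$; empty sums are $0$. $\chi_{\mathcal P}$ equals $1$ if the predicate $\mathcal P$ holds and $0$ otherwise. An $n\times n$ alternating sign matrix (ASM) is an $n\times n$ matrix with entries in $\{0,1,-1\}$ such that in each row and each column the non-zero entries alternate in sign and the first and last non-zero entries are $1$ (so every row and column sums to $1$). An HTSASM is an $n\times n$ ASM $X$ with $x_{i,j}=x_{n+1-i,n+1-j}$ for all $i,j\in[n]$. With $k=\lfloor n/2\rfloor$, the set of core positions is $C=[n]\times[k]$ if $n$ is even and $C=([n]\times[k])\cup([k]\times\{k+1\})$ if $n$ is odd. The core of an HTSASM $X$ is $(x_{i,j})_{(i,j)\in C}\in\mathbb R^{C}$, and $P^{\mathrm{core}}_{\mathrm{HTSASM}}\subseteq\mathbb R^{C}$ is the convex hull of the cores of all $n\times n$ HTSASMs. A facet of a polytope $P$ is a face of dimension $\dim P-1$; by "the face $\{L(Y)=c\}$" we mean $\{Y\in P^{\mathrm{core}}_{\mathrm{HTSASM}}: L(Y)=c\}$. *)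

theory Defs
  imports "HOL-Analysis.Analysis"
begin

text \<open>Matrices are functions \<^typ>\<open>nat \<Rightarrow> nat \<Rightarrow> real\<close> with rows and columns indexed from 1; only the
  entries with both indices in \<open>{1..n}\<close> matter.\<close>

definition alternating_line :: "real list \<Rightarrow> bool" where
  "alternating_line xs \<longleftrightarrow>
     set xs \<subseteq> {0, 1, -1} \<and>
     (let zs = filter (\<lambda>x. x \<noteq> 0) xs in
        zs \<noteq> [] \<and> hd zs = 1 \<and> last zs = 1 \<and> successively (\<lambda>a b. a * b < 0) zs)"

definition is_ASM :: "nat \<Rightarrow> (nat \<Rightarrow> nat \<Rightarrow> real) \<Rightarrow> bool" where
  "is_ASM n X \<longleftrightarrow>
     (\<forall>i\<in>{1..n}. alternating_line (map (\<lambda>j. X i j) [1..<n+1])) \<and>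
     (\<forall>j\<in>{1..n}. alternating_line (map (\<lambda>i. X i j) [1..<n+1]))"

definition is_HTSASM :: "nat \<Rightarrow> (nat \<Rightarrow> nat \<Rightarrow> real) \<Rightarrow> bool" where
  "is_HTSASM n X \<longleftrightarrow>
     is_ASM n X \<and> (\<forall>i\<in>{1..n}. \<forall>j\<in>{1..n}. X i j = X (n + 1 - i) (n + 1 - j))"

definition core_positions :: "nat \<Rightarrow> (nat \<times> nat) set" where
  "core_positions n =
     (if even n then {1..n} \<times> {1..n div 2}
      else {1..n} \<times> {1..n div 2} \<union> {1..n div 2} \<times> {n div 2 + 1})"

text \<open>The space of real families indexed by \<^term>\<open>core_positions n\<close> is modelled as \<open>real ^ 'c\<close>,
  where the finite type \<open>'c\<close> comes with a bijection \<open>idx\<close> from \<open>UNIV :: 'c set\<close> onto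
  \<^term>\<open>core_positions n\<close>, so that \<^term>\<open>core_entry idx Y i j\<close> is the coordinate of \<open>Y\<close>
  at the position \<open>(i, j)\<close>.\<close>

definition core_entry :: "('c \<Rightarrow> nat \<times> nat) \<Rightarrow> real ^ 'c \<Rightarrow> nat \<Rightarrow> nat \<Rightarrow> real" where
  "core_entry idx Y i j = Y $ (inv idx (i, j))"

definition core :: "('c \<Rightarrow> nat \<times> nat) \<Rightarrow> (nat \<Rightarrow> nat \<Rightarrow> real) \<Rightarrow> real ^ 'c" where
  "core idx X = (\<chi> c. X (fst (idx c)) (snd (idx c)))"

definition HTSASM_core_polytope :: "nat \<Rightarrow> ('c::finite \<Rightarrow> nat \<times> nat) \<Rightarrow> (real ^ 'c) set" where
  "HTSASM_core_polytope n idx = convex hull (core idx ` {X. is_HTSASM n X})"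

datatype partial_sum = R nat nat | K nat nat | M nat | N nat

text \<open>In the second sum of the \<open>R\<close> case, the half-turn symmetry replaces the entries to the right of
  the core by core entries. Here \<open>(n + 1) div 2\<close> is the ceiling of \<open>n / 2\<close>.\<close>

fun eval_sum :: "nat \<Rightarrow> ('c \<Rightarrow> nat \<times> nat) \<Rightarrow> partial_sum \<Rightarrow> real ^ 'c \<Rightarrow> real" where
  "eval_sum n idx (R i j) Y =
     (\<Sum>j'=1..min ((n + 1) div 2) j. core_entry idx Y i j') +
     (\<Sum>j'=(n + 1) div 2 + 1..j. core_entry idx Y (n + 1 - i) (n + 1 - j'))"
| "eval_sum n idx (K i j) Y = (\<Sum>i'=1..i. core_entry idx Y i' j)"
| "eval_sum n idx (M j) Y = (\<Sum>j'=1..j. core_entry idx Y ((n + 1) div 2) j')"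
| "eval_sum n idx (N i) Y = (\<Sum>i'=1..i. core_entry idx Y i' ((n + 1) div 2))"

definition sum_face ::
  "nat \<Rightarrow> ('c::finite \<Rightarrow> nat \<times> nat) \<Rightarrow> partial_sum \<times> real \<Rightarrow> (real ^ 'c) set" where
  "sum_face n idx = (\<lambda>(L, c). {Y \<in> HTSASM_core_polytope n idx. eval_sum n idx L Y = c})"

text \<open>The pair \<open>(L, c)\<close> stands for the equation \<open>L(Y) = c\<close>.\<close>

definition facet_equations :: "nat \<Rightarrow> (partial_sum \<times> real) set" where
  "facet_equations n = (let k = n div 2 in
     {(R i j, 0) | i j. (i, j) \<in> {(1, 1)} \<union> {2..k} \<times> {1..n - 2}} \<union>
     {(R i j, 1) | i j. (i, j) \<in> {(1, n - 1)} \<union> {2..k} \<times> {2..n - 1}} \<union>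
     {(K i j, 0) | i j. (i, j) \<in> {1..n - 2} \<times> {2..k}} \<union>
     {(K i j, 1) | i j. (i, j) \<in> {2..n - 1} \<times> {2..k}} \<union>
     (if odd n then
        {(M j, 0) | j. j \<in> {1..k}} \<union> {(M j, 1) | j. j \<in> {2..k}} \<union>
        {(N i, 0) | i. i \<in> {1..k - 1}} \<union> {(N i, 1) | i. i \<in> {2..k - 1}}
      else {}))"

end

theory Submission
  imports Defs
begin

text \<open>Encode a half-turn symmetric matrix by its corner sums. All constraints then become bounds
  \<open>0 \<le> c(p) - c(q) \<le> 1\<close> between neighbouring corner sums, together with integral boundary values and
  the half-turn symmetry, which relates \<open>c(p)\<close> and \<open>c(q)\<close> up to an integer. Shifting all corner sums
  with the same fractional part in either direction keeps such a system satisfied, so its extreme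
  points are integral, that is, cores of HTSASMs. The uniform matrix satisfies all listed
  inequalities strictly, and for each of them there is a point violating only that one: start from a
  suitable feasible point and shift a single corner sum together with its image under the half-turn.
  Hence the listed description is irredundant, and its inequalities correspond to the facets.\<close>

text \<open>The half-turn turns a partial sum into one minus another partial sum, so an upper bound
  in one place is a lower bound elsewhere; this is why the listed rows and columns stop at the
  middle. For odd \<open>n\<close> the central row and the central column are their own images, and
  they share a value: with \<open>k = n div 2\<close>,
  \<open>col_sum c k (k + 1) = row_sum c (k + 1) k\<close>. Hence the \<open>N\<close> family stops
  at \<open>k - 1\<close>. In the first row and the first column the partial sums are monotone,
  which leaves one bound at each end.

  The obstacle to irredundancy is that shifting one corner sum moves four partial sums and their
  images, and that sums tied by such identities move together. A witness can therefore break several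
  bounds on partial sums, but among the listed ones it must break exactly one. The facet criterion
  is stated relative to an affine set because the row and column sums already confine the cores to a
  proper affine subspace.\<close>

subsection \<open>Facets from separately violated inequalities\<close>

lemma bij_betw_facets_of_violated_separately:
  fixes f :: "'e \<Rightarrow> 'a::euclidean_space \<Rightarrow> real"
  assumes "affine A" "finite E"
    and lin: "\<And>e. e \<in> E \<Longrightarrow> linear (f e)"
    and S: "S = A \<inter> {x. \<forall>e\<in>E. f e x \<le> b e}"
    and s: "s \<in> A" "\<And>e. e \<in> E \<Longrightarrow> f e s < b e"
    and viol: "\<And>e. e \<in> E \<Longrightarrow> \<exists>z\<in>A. f e z > b e \<and> (\<forall>e'\<in>E - {e}. f e' z \<le> b e')"
  shows "bij_betw (\<lambda>e. S \<inter> {x. f e x = b e}) E {F. F facet_of S}"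
proof -
  define a where "a e = adjoint (f e) 1" for e
  have fa: "f e x = a e \<bullet> x" if "e \<in> E" for e x
    using adjoint_works[OF lin[OF that], of x 1] by (simp add: a_def inner_commute)
  define H where "H e = {x. a e \<bullet> x \<le> b e}" for e
  from viol obtain z where zA: "\<And>e. e \<in> E \<Longrightarrow> z e \<in> A"
    and z: "\<And>e. e \<in> E \<Longrightarrow> f e (z e) > b e"
    and z': "\<And>e e'. e \<in> E \<Longrightarrow> e' \<in> E \<Longrightarrow> e' \<noteq> e \<Longrightarrow> f e' (z e) \<le> b e'"
    by (metis Diff_iff singletonD)
  have zH: "z e \<notin> H e" if "e \<in> E" for e
    using z[OF that] fa[OF that] by (simp add: H_def)
  have zH': "z e \<in> H e'" if "e \<in> E" "e' \<in> E" "e' \<noteq> e" for e e'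
    using z'[OF that] fa that by (simp add: H_def)
  have inj: "inj_on H E"
    by (metis inj_onI zH zH')
  have SH: "S = A \<inter> \<Inter>(H ` E)"
    using fa by (auto simp: S H_def)
  have aff: "affine hull S = A"
  proof -
    define T where "T = (\<Inter>e\<in>E. {x. a e \<bullet> x < b e})"
    have "open T"
      unfolding T_def using \<open>finite E\<close> by (intro open_INT ballI open_halfspace_lt)
    moreover have "s \<in> A \<inter> T"
      using s fa by (auto simp: T_def)
    ultimately have "affine hull (A \<inter> T) = A"
      using affine_hull_affine_Int_open[OF \<open>affine A\<close>] by (metis affine_hull_eq assms(1) empty_iff)
    moreover have "A \<inter> T \<subseteq> S"
      by (force simp: SH T_def H_def)
    ultimately have "A \<subseteq> affine hull S"
      by (metis hull_mono)
    moreover have "affine hull S \<subseteq> A"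
      by (metis Int_lower1 SH assms(1) hull_minimal)
    ultimately show ?thesis by blast
  qed
  \<comment> \<open>The description of facets used below is indexed by half-spaces as sets, so the
    inequality has to be recovered from its half-space. The violating points guarantee that distinct
    inequalities have distinct half-spaces.\<close>
  define e_of where "e_of = the_inv_into E H"
  have e_of: "e_of (H e) = e" if "e \<in> E" for e
    unfolding e_of_def using inj that by (rule the_inv_into_f_f)
  have facet: "C facet_of S \<longleftrightarrow> (\<exists>h. h \<in> H ` E \<and> C = S \<inter> {x. a (e_of h) \<bullet> x = b (e_of h)})" for C
  proof (rule facet_of_polyhedron_explicit)
    show "finite (H ` E)" using \<open>finite E\<close> by simp
    show "S = affine hull S \<inter> \<Inter>(H ` E)" using SH aff by simp
    show "a (e_of h) \<noteq> 0 \<and> h = {x. a (e_of h) \<bullet> x \<le> b (e_of h)}" if "h \<in> H ` E" for h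
    proof -
      from that obtain e where e: "e \<in> E" "h = H e" by blast
      then show ?thesis
        using z[of e] s(2)[of e] fa[of e] by (auto simp: e_of) (auto simp: H_def)
    qed
    show "S \<subset> affine hull S \<inter> \<Inter>F'" if "F' \<subset> H ` E" for F'
    proof -
      from that obtain e where e: "e \<in> E" "H e \<notin> F'" by blast
      have "z e \<in> h" if "h \<in> F'" for h
        using e that \<open>F' \<subset> H ` E\<close> zH'[of e] by blast
      then have "z e \<in> A \<inter> \<Inter>F'" using zA e by blast
      moreover have "z e \<notin> S" using zH e by (auto simp: SH)
      moreover have "S \<subseteq> A \<inter> \<Inter>F'" using that unfolding SH by blast
      ultimately show ?thesis unfolding aff by blast
    qed
  qed
  have "{F. F facet_of S} = (\<lambda>e. S \<inter> {x. f e x = b e}) ` E"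
    by (auto simp: facet e_of fa)
  moreover have "inj_on (\<lambda>e. S \<inter> {x. f e x = b e}) E"
  proof (rule inj_onI, rule ccontr)
    fix e e' assume e: "e \<in> E" "e' \<in> E" "e \<noteq> e'"
      and eq: "S \<inter> {x. f e x = b e} = S \<inter> {x. f e' x = b e'}"
    \<comment> \<open>The parameter at which the segment from \<open>s\<close> to \<open>z e\<close>
      crosses the hyperplane of \<open>e\<close>. At the crossing point \<open>p\<close> every other
      inequality is strict, being strict at \<open>s\<close> and valid at \<open>z e\<close>, so
      \<open>p\<close> lies in no other face of the family.\<close>
    define t where "t = (b e - f e s) / (f e (z e) - f e s)"
    have t: "0 < t" "t < 1"
      using z[of e] s(2)[of e] e by (auto simp: t_def)
    define p where "p = (1 - t) *\<^sub>R s + t *\<^sub>R z e"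
    have fp: "f d p = (1 - t) * f d s + t * f d (z e)" if "d \<in> E" for d
      using lin[OF that] by (simp add: p_def linear_add linear_cmul)
    have "p \<in> A"
      unfolding p_def using \<open>affine A\<close> s(1) zA[OF e(1)] by (simp add: mem_affine)
    have "f e (z e) - f e s \<noteq> 0"
      using z[of e] s(2)[of e] e by auto
    then have "t * (f e (z e) - f e s) = b e - f e s"
      by (simp add: t_def)
    then have pe: "f e p = b e"
      by (simp add: fp[OF e(1)] algebra_simps)
    have less: "f d p < b d" if "d \<in> E" "d \<noteq> e" for d
    proof -
      have "(1 - t) * f d s < (1 - t) * b d" using t s(2)[OF that(1)] by simp
      moreover have "t * f d (z e) \<le> t * b d" using t z'[OF e(1) that] by simp
      ultimately show ?thesis by (simp add: fp[OF that(1)] algebra_simps)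
    qed
    have "p \<in> S"
      using \<open>p \<in> A\<close> pe less by (fastforce simp: S)
    with pe eq have "f e' p = b e'" by blast
    with less[of e'] e show False by auto
  qed
  ultimately show ?thesis
    by (simp add: bij_betw_def)
qed

subsection \<open>Alternating lines and partial sums\<close>

text \<open>A two-state automaton: the state \<open>s\<close> is the sum of the entries already
  read, and it must return to 0 or 1 after each entry and end at 1.\<close>

fun walks_to_one :: "real \<Rightarrow> real list \<Rightarrow> bool" where
  "walks_to_one s [] \<longleftrightarrow> s = 1"
| "walks_to_one s (x # xs) \<longleftrightarrow> s + x \<in> {0, 1} \<and> walks_to_one (s + x) xs"

lemma walks_to_one_iff_sum_list:
  "walks_to_one s xs \<longleftrightarrow>
     s + sum_list xs = 1 \<and> (\<forall>m\<in>{1..length xs}. s + sum_list (take m xs) \<in> {0, 1})"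
proof (induction xs arbitrary: s)
  case (Cons x xs)
  define Q where "Q m \<longleftrightarrow> s + sum_list (take m (x # xs)) \<in> {0, 1}" for m
  have *: "{1..length (x # xs)} = insert 1 (Suc ` {1..length xs})"
    by auto
  have Q: "s + x \<in> {0, 1} \<longleftrightarrow> Q 1"
    "\<And>m. s + x + sum_list (take m xs) \<in> {0, 1} \<longleftrightarrow> Q (Suc m)"
    by (simp_all add: Q_def add.assoc)
  show ?case
    unfolding walks_to_one.simps Cons.IH Q Q_def[symmetric] * by (auto simp: add.assoc simp del: image_Suc_atLeastAtMost)
qed auto

text \<open>Both states have to be treated in one induction, since an entry 1 or -1 switches between
  them. State 1 is remembered by a leading 1, which stands for the last non-zero entry read.\<close>

lemma walks_to_one_iff_alternating:
  "(walks_to_one 0 xs \<longleftrightarrow> alternating_line xs) \<and>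
   (walks_to_one 1 xs \<longleftrightarrow> alternating_line (1 # xs))"
proof (induction xs)
  case Nil
  then show ?case by (simp add: alternating_line_def)
next
  case (Cons x xs)
  have z: "alternating_line (0 # ys) = alternating_line ys"
    "alternating_line (1 # 0 # ys) = alternating_line (1 # ys)" for ys
    by (auto simp: alternating_line_def Let_def)
  consider "x = 0" | "x = 1" | "x = -1" | "x \<notin> {0,1,-1}" by blast
  then show ?case
  proof cases
    case 1
    then show ?thesis using Cons by (auto simp: z alternating_line_def)
  next
    case 2
    then show ?thesis using Cons
      by (auto simp: alternating_line_def)
  next
    case 3
    \<comment> \<open>After the -1 the next non-zero entry must be positive, exactly the condition
      on the head of \<open>xs\<close> alone. If \<open>xs\<close> has no non-zero entry, both sides
      fail, the left one because its last non-zero entry is -1.\<close>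
    have "alternating_line (1 # -1 # xs) \<longleftrightarrow> alternating_line xs"
    proof (cases "filter (\<lambda>x. x \<noteq> 0) xs")
      case (Cons a zs)
      then have "a \<in> set xs" "a \<noteq> 0"
        using filter_eq_ConsD[OF Cons] by auto
      with Cons show ?thesis by (auto simp: alternating_line_def Let_def)
    qed (auto simp: alternating_line_def Let_def)
    with 3 show ?thesis using Cons
      by (auto simp: alternating_line_def)
  next
    case 4
    then show ?thesis
      by (auto simp: alternating_line_def)
  qed
qed

text \<open>Relaxing \<open>{0, 1}\<close> to the interval from 0 to 1 in this form gives the linear
  condition \<open>feasible\<close>, so integrality is all that separates feasible half-turn
  symmetric corner sums from HTSASMs.\<close>

lemma alternating_line_iff_partial_sums:
  "alternating_line (map f [1..<n + 1]) \<longleftrightarrow>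
     (\<forall>m\<in>{1..n}. (\<Sum>j=1..m. f j) \<in> {0, 1}) \<and> (\<Sum>j=1..n. f j) = 1"
proof -
  have s: "sum_list (map f [1..<m + 1]) = (\<Sum>j=1..m. f j)" for m
    by (simp add: interv_sum_list_conv_sum_set_nat atLeastLessThanSuc_atLeastAtMost del: upt_Suc)
  have "sum_list (take m (map f [1..<n + 1])) = (\<Sum>j=1..m. f j)" if "m \<le> n" for m
    using that s[of m] by (simp add: take_map take_upt del: upt_Suc)
  then show ?thesis
    using walks_to_one_iff_sum_list[of 0 "map f [1..<n + 1]"]
      walks_to_one_iff_alternating[of "map f [1..<n + 1]"] s[of n]
    by (auto simp del: upt_Suc)
qed

subsection \<open>Corner sums\<close>

text \<open>A function \<open>c\<close> of this section encodes the matrix \<open>entry c\<close> whose upper left \<open>u \<times> v\<close> block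
  has sum \<open>c u v\<close>. Since \<open>i - 1\<close> is truncated, the entries and partial sums are meaningful only for
  \<open>i, j \<ge> 1\<close>, except that \<open>row_sum c i 0\<close> and \<open>col_sum c 0 j\<close> are empty sums.\<close>

definition entry :: "(nat \<Rightarrow> nat \<Rightarrow> real) \<Rightarrow> nat \<Rightarrow> nat \<Rightarrow> real" where
  "entry c i j = c i j - c (i - 1) j - c i (j - 1) + c (i - 1) (j - 1)"

definition row_sum :: "(nat \<Rightarrow> nat \<Rightarrow> real) \<Rightarrow> nat \<Rightarrow> nat \<Rightarrow> real" where
  "row_sum c i j = c i j - c (i - 1) j"

definition col_sum :: "(nat \<Rightarrow> nat \<Rightarrow> real) \<Rightarrow> nat \<Rightarrow> nat \<Rightarrow> real" where
  "col_sum c i j = c i j - c i (j - 1)"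

text \<open>The boundary values say that all rows and columns sum to 1. By inclusion and exclusion
  the block of rows beyond \<open>u\<close> and columns beyond \<open>v\<close> then has sum
  \<open>n - u - v + c u v\<close>; the last condition equates it with the upper left block onto
  which the half-turn maps it.\<close>

definition ht_corner :: "nat \<Rightarrow> (nat \<Rightarrow> nat \<Rightarrow> real) \<Rightarrow> bool" where
  "ht_corner n c \<longleftrightarrow>
     (\<forall>u\<le>n. c u 0 = 0 \<and> c 0 u = 0 \<and> c u n = real u \<and> c n u = real u) \<and>
     (\<forall>u\<le>n. \<forall>v\<le>n. c (n - u) (n - v) = real n - real u - real v + c u v)"

definition feasible :: "nat \<Rightarrow> (nat \<Rightarrow> nat \<Rightarrow> real) \<Rightarrow> bool" where
  "feasible n c \<longleftrightarrow>
     (\<forall>i\<in>{1..n}. \<forall>j\<le>n. row_sum c i j \<in> {0..1}) \<and> (\<forall>i\<le>n. \<forall>j\<in>{1..n}. col_sum c i j \<in> {0..1})"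

lemma ht_cornerD:
  assumes "ht_corner n c" "u \<le> n"
  shows "c u 0 = 0" "c 0 u = 0" "c u n = real u" "c n u = real u"
  using assms by (auto simp: ht_corner_def)

lemma ht_corner_rotate:
  assumes "ht_corner n c" "u \<le> n" "v \<le> n"
  shows "c (n - u) (n - v) = real n - real u - real v + c u v"
  using assms by (auto simp: ht_corner_def)

text \<open>The first \<open>n - j\<close> entries of row \<open>n + 1 - i\<close> are the last
  \<open>n - j\<close> entries of row \<open>i\<close> in reverse order, and the row sums to 1. This
  identity exchanges lower and upper bounds throughout.\<close>

lemma row_sum_rotate:
  assumes "ht_corner n c" "1 \<le> i" "i \<le> n" "j \<le> n"
  shows "row_sum c (n + 1 - i) (n - j) = 1 - row_sum c i j"
proof -
  have "n + 1 - i = n - (i - 1)" "n + 1 - i - 1 = n - i" using assms by auto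
  then show ?thesis
    using ht_corner_rotate[OF assms(1), of "i - 1" j] ht_corner_rotate[OF assms(1), of i j] assms
    by (simp add: row_sum_def of_nat_diff)
qed

lemma col_sum_rotate:
  assumes "ht_corner n c" "i \<le> n" "1 \<le> j" "j \<le> n"
  shows "col_sum c (n - i) (n + 1 - j) = 1 - col_sum c i j"
proof -
  have "n + 1 - j = n - (j - 1)" "n + 1 - j - 1 = n - j" using assms by auto
  then show ?thesis
    using ht_corner_rotate[OF assms(1), of i "j - 1"] ht_corner_rotate[OF assms(1), of i j] assms
    by (simp add: col_sum_def of_nat_diff)
qed

lemma entry_conv_row_sum: "entry c i j = row_sum c i j - row_sum c i (j - 1)"
  by (simp add: entry_def row_sum_def)

lemma entry_conv_col_sum: "entry c i j = col_sum c i j - col_sum c (i - 1) j"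
  by (simp add: entry_def col_sum_def)

lemma entry_rotate:
  assumes "ht_corner n c" "1 \<le> i" "i \<le> n" "1 \<le> j" "j \<le> n"
  shows "entry c (n + 1 - i) (n + 1 - j) = entry c i j"
proof -
  have "n + 1 - j = n - (j - 1)" "n + 1 - j - 1 = n - j" using assms by auto
  then show ?thesis
    using row_sum_rotate[OF assms(1), of i "j - 1"] row_sum_rotate[OF assms(1), of i j] assms
    by (simp add: entry_conv_row_sum)
qed

lemma row_sum_trivial:
  assumes "ht_corner n c" "1 \<le> i" "i \<le> n"
  shows "row_sum c i 0 = 0" "row_sum c i n = 1"
  using assms by (simp_all add: row_sum_def ht_cornerD of_nat_diff)

lemma col_sum_trivial:
  assumes "ht_corner n c" "1 \<le> j" "j \<le> n"
  shows "col_sum c 0 j = 0" "col_sum c n j = 1"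
  using assms by (simp_all add: col_sum_def ht_cornerD of_nat_diff)

lemma sum_entry_row:
  assumes "ht_corner n c" "1 \<le> i" "i \<le> n"
  shows "(\<Sum>j=1..m. entry c i j) = row_sum c i m"
proof (induction m)
  case 0
  then show ?case using assms by (simp add: row_sum_trivial)
next
  case (Suc m)
  then show ?case by (simp add: entry_conv_row_sum)
qed

lemma sum_entry_col:
  assumes "ht_corner n c" "1 \<le> j" "j \<le> n"
  shows "(\<Sum>i=1..m. entry c i j) = col_sum c m j"
proof (induction m)
  case 0
  then show ?case using assms by (simp add: col_sum_trivial)
next
  case (Suc m)
  then show ?case by (simp add: entry_conv_col_sum)
qed

lemma ht_corner_combine:
  assumes "ht_corner n c" "ht_corner n d" "a + b = 1"
  shows "ht_corner n (\<lambda>u v. a * c u v + b * d u v)"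
proof -
  have x: "a * x + b * x = x" for x
    using assms(3) by (metis distrib_right mult_1)
  have "a * (x + c u v) + b * (x + d u v) = x + (a * c u v + b * d u v)" for x u v
    using x[of x] by (simp add: algebra_simps)
  with x show ?thesis
    using assms(1,2) by (simp add: ht_corner_def)
qed

lemma HTSASM_entry:
  assumes "ht_corner n c" "feasible n c"
    and int: "\<And>u v. u \<le> n \<Longrightarrow> v \<le> n \<Longrightarrow> c u v \<in> \<int>"
  shows "is_HTSASM n (entry c)"
proof -
  have 01: "x \<in> {0, 1}" if "x \<in> \<int>" "x \<in> {0..1}" for x :: real
    using that by (auto elim!: Ints_cases)
  have row: "row_sum c i j \<in> {0, 1}" if "i \<in> {1..n}" "j \<le> n" for i j
    using that assms by (intro 01) (auto simp: feasible_def, simp add: row_sum_def int)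
  have col: "col_sum c i j \<in> {0, 1}" if "i \<le> n" "j \<in> {1..n}" for i j
    using that assms by (intro 01) (auto simp: feasible_def, simp add: col_sum_def int)
  show ?thesis
    unfolding is_HTSASM_def is_ASM_def alternating_line_iff_partial_sums
    using row col assms(1)
    by (auto simp: sum_entry_row sum_entry_col row_sum_trivial col_sum_trivial entry_rotate
        simp del: One_nat_def)
qed

section \<open>From half-turn symmetric alternating sign matrices to corner sums\<close>

definition corner_sum :: "(nat \<Rightarrow> nat \<Rightarrow> real) \<Rightarrow> nat \<Rightarrow> nat \<Rightarrow> real" where
  "corner_sum X u v = (\<Sum>i=1..u. \<Sum>j=1..v. X i j)"

lemma row_sum_corner_sum: "1 \<le> i \<Longrightarrow> row_sum (corner_sum X) i j = (\<Sum>j'=1..j. X i j')"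
  by (cases i) (simp_all add: row_sum_def corner_sum_def)

lemma col_sum_corner_sum: "1 \<le> j \<Longrightarrow> col_sum (corner_sum X) i j = (\<Sum>i'=1..i. X i' j)"
  by (cases j) (simp_all add: col_sum_def corner_sum_def sum.distrib)

lemma entry_corner_sum: "1 \<le> i \<Longrightarrow> 1 \<le> j \<Longrightarrow> entry (corner_sum X) i j = X i j"
  by (cases j) (simp_all add: entry_conv_row_sum row_sum_corner_sum)

lemma ht_corner_corner_sum:
  assumes "is_HTSASM n X"
  shows "ht_corner n (corner_sum X)" "feasible n (corner_sum X)"
proof -
  have line: "(\<Sum>j=1..m. f j) \<in> {0, 1}" "(\<Sum>j=1..n. f j) = 1"
    if "alternating_line (map f [1..<n + 1])" "m \<le> n" for f :: "nat \<Rightarrow> real" and m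
    using that(1)[unfolded alternating_line_iff_partial_sums] \<open>m \<le> n\<close> by (cases "m = 0"; simp)+
  have row: "(\<Sum>j=1..m. X i j) \<in> {0, 1}" "(\<Sum>j=1..n. X i j) = 1"
    if "i \<in> {1..n}" "m \<le> n" for i m
    using that assms line[of "X i" m] unfolding is_HTSASM_def is_ASM_def by blast+
  have col: "(\<Sum>i=1..m. X i j) \<in> {0, 1}" "(\<Sum>i=1..n. X i j) = 1"
    if "j \<in> {1..n}" "m \<le> n" for j m
    using that assms line[of "\<lambda>i. X i j" m] unfolding is_HTSASM_def is_ASM_def by blast+
  have 01: "x \<in> {0..1}" if "x \<in> {0, 1}" for x :: real
    using that by auto
  show "feasible n (corner_sum X)"
    using row(1)[THEN 01] col(1)[THEN 01]
    by (simp add: feasible_def row_sum_corner_sum col_sum_corner_sum)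
  let ?c = "corner_sum X"
  have b: "?c u 0 = 0" "?c 0 u = 0" for u
    by (simp_all add: corner_sum_def)
  have rown: "?c u n = real u" if "u \<le> n" for u
    using that row(2) by (simp add: corner_sum_def)
  have coln: "?c n v = real v" if "v \<le> n" for v
  proof -
    have "?c n v = (\<Sum>j=1..v. \<Sum>i=1..n. X i j)"
      unfolding corner_sum_def by (rule sum.swap)
    then show ?thesis using that col(2) by simp
  qed
  have sym: "X i j = X (n + 1 - i) (n + 1 - j)" if "i \<in> {1..n}" "j \<in> {1..n}" for i j
    using assms that unfolding is_HTSASM_def by blast
  have split: "(\<Sum>i=1..n. f i) = (\<Sum>i=1..u. f i) + (\<Sum>i=u+1..n. f i)" if "u \<le> n"
    for f :: "nat \<Rightarrow> real" and u
    using that by (metis le_add2 sum.ub_add_nat le_add_diff_inverse)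
  have flip: "(\<Sum>i=1..n-u. f i) = (\<Sum>i=u+1..n. f (n + 1 - i))" if "u \<le> n"
    for f :: "nat \<Rightarrow> real" and u
    by (rule sum.reindex_bij_witness[of _ "\<lambda>i. n + 1 - i" "\<lambda>i. n + 1 - i"]) auto
  have "?c (n - u) (n - v) = real n - real u - real v + ?c u v" if "u \<le> n" "v \<le> n" for u v
  proof -
    have "?c (n - u) (n - v) = (\<Sum>i=u+1..n. \<Sum>j=v+1..n. X (n + 1 - i) (n + 1 - j))"
      unfolding corner_sum_def flip[OF that(1)] flip[OF that(2)] ..
    also have "\<dots> = (\<Sum>i=u+1..n. \<Sum>j=v+1..n. X i j)"
      using sym by (intro sum.cong refl) auto
    also have "\<dots> = (\<Sum>i=u+1..n. (\<Sum>j=1..n. X i j) - (\<Sum>j=1..v. X i j))"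
      using split[OF that(2)] by (intro sum.cong refl) simp
    also have "\<dots> = (?c n n - ?c u n) - (?c n v - ?c u v)"
      unfolding sum_subtractf corner_sum_def
      using split[OF that(1), of "\<lambda>i. \<Sum>j=1..n. X i j"] split[OF that(1), of "\<lambda>i. \<Sum>j=1..v. X i j"]
      by simp
    finally show ?thesis using that by (simp add: rown coln)
  qed
  then show "ht_corner n ?c"
    by (simp add: ht_corner_def b rown coln)
qed

subsection \<open>The facet inequalities imply all bounds on partial sums\<close>

text \<open>What \<open>eval_sum\<close> computes on the core of \<open>entry c\<close>: once the
  half-turn supplies the entries to the right of the core, \<open>R\<close> is an ordinary row sum,
  and \<open>M\<close> and \<open>N\<close> are the sums in the central row and column.\<close>

fun corner_value :: "nat \<Rightarrow> (nat \<Rightarrow> nat \<Rightarrow> real) \<Rightarrow> partial_sum \<Rightarrow> real" where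
  "corner_value n c (R i j) = row_sum c i j"
| "corner_value n c (K i j) = col_sum c i j"
| "corner_value n c (M j) = row_sum c ((n + 1) div 2) j"
| "corner_value n c (N i) = col_sum c i ((n + 1) div 2)"

lemma facet_equationsE:
  assumes "e \<in> facet_equations n"
  obtains (R0) i j where "e = (R i j, 0)" "2 \<le> i" "i \<le> n div 2" "1 \<le> j" "j \<le> n - 2"
  | (R0') "e = (R 1 1, 0)"
  | (R1) i j where "e = (R i j, 1)" "2 \<le> i" "i \<le> n div 2" "2 \<le> j" "j \<le> n - 1"
  | (R1') "e = (R 1 (n - 1), 1)"
  | (K0) i j where "e = (K i j, 0)" "1 \<le> i" "i \<le> n - 2" "2 \<le> j" "j \<le> n div 2"
  | (K1) i j where "e = (K i j, 1)" "2 \<le> i" "i \<le> n - 1" "2 \<le> j" "j \<le> n div 2"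
  | (M0) j where "odd n" "e = (M j, 0)" "1 \<le> j" "j \<le> n div 2"
  | (M1) j where "odd n" "e = (M j, 1)" "2 \<le> j" "j \<le> n div 2"
  | (N0) i where "odd n" "e = (N i, 0)" "1 \<le> i" "i \<le> n div 2 - 1"
  | (N1) i where "odd n" "e = (N i, 1)" "2 \<le> i" "i \<le> n div 2 - 1"
  using assms unfolding facet_equations_def Let_def by (auto split: if_splits)

lemma mem_facet_equations:
  "(R i j, b) \<in> facet_equations n \<longleftrightarrow>
     b = 0 \<and> (i = 1 \<and> j = 1 \<or> i \<in> {2..n div 2} \<and> j \<in> {1..n - 2}) \<or>
     b = 1 \<and> (i = 1 \<and> j = n - 1 \<or> i \<in> {2..n div 2} \<and> j \<in> {2..n - 1})"
  "(K i j, b) \<in> facet_equations n \<longleftrightarrow>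
     b = 0 \<and> i \<in> {1..n - 2} \<and> j \<in> {2..n div 2} \<or> b = 1 \<and> i \<in> {2..n - 1} \<and> j \<in> {2..n div 2}"
  "(M j, b) \<in> facet_equations n \<longleftrightarrow>
     odd n \<and> (b = 0 \<and> j \<in> {1..n div 2} \<or> b = 1 \<and> j \<in> {2..n div 2})"
  "(N i, b) \<in> facet_equations n \<longleftrightarrow>
     odd n \<and> (b = 0 \<and> i \<in> {1..n div 2 - 1} \<or> b = 1 \<and> i \<in> {2..n div 2 - 1})"
  unfolding facet_equations_def Let_def by auto

lemma finite_facet_equations: "finite (facet_equations n)"
proof -
  have "facet_equations n \<subseteq> (case_prod R ` ({..n + 1} \<times> {..n + 1}) \<union> case_prod K ` ({..n + 1} \<times> {..n + 1}) \<union>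
      M ` {..n + 1} \<union> N ` {..n + 1}) \<times> {0, 1}"
    by (auto elim!: facet_equationsE simp: image_iff)
  then show ?thesis by (rule finite_subset) auto
qed

text \<open>The factor is -1 for \<open>b = 0\<close> and 1 for \<open>b = 1\<close>, so that
  \<open>L \<ge> 0\<close> and \<open>L \<le> 1\<close> both take the form
  \<open>signed_sum n idx e Y \<le> snd e\<close>.\<close>

definition signed_sum :: "nat \<Rightarrow> ('c \<Rightarrow> nat \<times> nat) \<Rightarrow> partial_sum \<times> real \<Rightarrow> real ^ 'c \<Rightarrow> real" where
  "signed_sum n idx = (\<lambda>(L, b) Y. (2 * b - 1) * eval_sum n idx L Y)"

lemma linear_eval_sum: "linear (eval_sum n idx L)"
proof (rule linearI)
  show "eval_sum n idx L (x + y) = eval_sum n idx L x + eval_sum n idx L y" for x y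
    by (cases L) (simp_all add: core_entry_def sum.distrib)
  show "eval_sum n idx L (r *\<^sub>R x) = r *\<^sub>R eval_sum n idx L x" for r x
    by (cases L) (simp_all add: core_entry_def sum_distrib_left distrib_left)
qed

lemma linear_signed_sum: "linear (signed_sum n idx e)"
proof (cases e)
  case (Pair L b)
  show ?thesis
    using linear_compose_scale_right[OF linear_eval_sum, of "2 * b - 1" n idx L]
    by (simp add: signed_sum_def Pair)
qed

lemma feasible_corner_value:
  assumes "feasible n c" "e \<in> facet_equations n" "n \<ge> 4"
  shows "corner_value n c (fst e) \<in> {0..1}"
  using assms(2) by (cases rule: facet_equationsE) (use assms in \<open>auto simp: feasible_def\<close>)

text \<open>Inner rows and columns beyond the middle are rotated back to listed ones. The bounds
  then left over concern the outer rows and columns, where they follow from monotonicity and the two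
  bounds at the ends of the first row.\<close>

lemma feasible_if_facet_inequalities:
  assumes c: "ht_corner n c" and "n \<ge> 4"
    and ineq: "\<And>L. (L, 0) \<in> facet_equations n \<Longrightarrow> corner_value n c L \<ge> 0"
      "\<And>L. (L, 1) \<in> facet_equations n \<Longrightarrow> corner_value n c L \<le> 1"
  shows "feasible n c"
proof -
  define k where "k = n div 2"
  have k: "2 \<le> k" "n = 2 * k \<or> n = 2 * k + 1" and odd: "odd n \<longleftrightarrow> n = 2 * k + 1"
    using \<open>n \<ge> 4\<close> by (auto simp: k_def)
  have half: "(n + 1) div 2 = k + 1" if "odd n" using that odd by simp
  note rot = row_sum_rotate[OF c] and rot' = col_sum_rotate[OF c]
  \<comment> \<open>The positions \<open>(k, k + 1)\<close> and \<open>(k + 1, k)\<close> are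
    exchanged by the half-turn and their corner sums agree. This transfers bounds from the central
    row to the two steps \<open>k\<close> and \<open>k + 1\<close> of the central column that
    \<open>N\<close> leaves open.\<close>
  have center: "col_sum c k (k + 1) = row_sum c (k + 1) k" if "odd n"
    using ht_corner_rotate[OF c, of k "k + 1"] that odd by (simp add: row_sum_def col_sum_def)
  have row0: "row_sum c i j \<ge> 0" if "i \<in> {2..n - 1}" "j \<in> {1..n - 2}" for i j
  proof -
    consider "i \<le> k" | "i = k + 1" "odd n" "j \<le> k" | "i = k + 1" "odd n" "j > k" | "n + 1 - i \<le> k"
      using k odd by fastforce
    then show ?thesis
    proof cases
      case 1
      then show ?thesis using ineq(1)[of "R i j"] that by (simp add: mem_facet_equations k_def)
    next
      case 2
      then show ?thesis using ineq(1)[of "M j"] that half by (simp add: mem_facet_equations k_def)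
    next
      case 3
      then have "2 \<le> n - j" "n - j \<le> k" using that odd by auto
      then have "row_sum c i (n - j) \<le> 1"
        using ineq(2)[of "M (n - j)"] 3 half by (simp add: mem_facet_equations k_def)
      then show ?thesis using rot[of i j] 3 that k odd by auto
    next
      case 4
      have "2 \<le> n + 1 - i" "2 \<le> n - j" "n - j \<le> n - 1" using that by auto
      with 4 have "row_sum c (n + 1 - i) (n - j) \<le> 1"
        using ineq(2)[of "R (n + 1 - i) (n - j)"] by (simp add: mem_facet_equations k_def)
      then show ?thesis using rot[of i j] that by auto
    qed
  qed
  have row1: "row_sum c i j \<le> 1" if "i \<in> {2..n - 1}" "j \<in> {2..n - 1}" for i j
  proof -
    have "n + 1 - i \<in> {2..n - 1}" "n - j \<in> {1..n - 2}" using that by auto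
    from row0[OF this] show ?thesis using rot[of i j] that by auto
  qed
  have col0: "col_sum c i j \<ge> 0" if "i \<in> {1..n - 2}" "j \<in> {2..n - 1}" for i j
  proof -
    have "j \<le> k \<or> n + 1 - j \<le> k \<or> j = k + 1 \<and> odd n"
      using that k(2) odd by auto
    moreover have "i \<le> k - 1 \<or> i = k \<or> i = k + 1 \<or> i > k + 1" by linarith
    ultimately have middle: "j \<le> k \<or> n + 1 - j \<le> k \<or>
        j = k + 1 \<and> odd n \<and> (i \<le> k - 1 \<or> i = k \<or> i = k + 1 \<or> i > k + 1)"
      by blast
    consider "j \<le> k" | "j = k + 1" "odd n" "i \<le> k - 1" | "j = k + 1" "odd n" "i = k" 
      | "j = k + 1" "odd n" "i = k + 1" | "j = k + 1" "odd n" "i > k + 1" | "n + 1 - j \<le> k"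
      using middle by blast
    then show ?thesis
    proof cases
      case 1
      then show ?thesis using ineq(1)[of "K i j"] that by (simp add: mem_facet_equations k_def)
    next
      case 2
      then show ?thesis using ineq(1)[of "N i"] that half by (simp add: mem_facet_equations k_def)
    next
      case 3
      then show ?thesis using row0[of "k + 1" k] center k odd by auto
    next
      case 4
      then show ?thesis using row1[of "k + 1" k] center k odd rot'[of k "k + 1"] by auto
    next
      case 5
      then have "2 \<le> n - i" "n - i \<le> k - 1" using that odd by auto
      then have "col_sum c (n - i) j \<le> 1"
        using ineq(2)[of "N (n - i)"] 5 half by (simp add: mem_facet_equations k_def)
      then show ?thesis using rot'[of i j] 5 that k odd by auto
    next
      case 6
      have "2 \<le> n + 1 - j" "2 \<le> n - i" "n - i \<le> n - 1" using that by auto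
      with 6 have "col_sum c (n - i) (n + 1 - j) \<le> 1"
        using ineq(2)[of "K (n - i) (n + 1 - j)"] by (simp add: mem_facet_equations k_def)
      then show ?thesis using rot'[of i j] that by auto
    qed
  qed
  have corner: "c 1 1 \<ge> 0" "c 1 (n - 1) \<le> 1"
    using ineq(1)[of "R 1 1"] ineq(2)[of "R 1 (n - 1)"] ht_cornerD(2)[OF c, of 1]
      ht_cornerD(2)[OF c, of "n - 1"] \<open>n \<ge> 4\<close>
    by (simp_all add: mem_facet_equations row_sum_def)
  text \<open>In the first row and the first column, the corner sums coincide with the partial sums.\<close>
  have mono1: "c 1 j \<le> c 1 j'" if "1 \<le> j" "j \<le> j'" "j' \<le> n - 1" for j j'
    using that(2,3)
  proof (induction j' rule: dec_induct)
    case (step m)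
    then have "1 \<in> {1..n - 2}" "Suc m \<in> {2..n - 1}" using that \<open>n \<ge> 4\<close> by auto
    from col0[OF this] step show ?case by (simp add: col_sum_def)
  qed simp
  have first_row: "c 1 j \<in> {0..1}" if j: "j \<le> n" for j
  proof -
    consider "j = 0" | "j = n" | "1 \<le> j" "j \<le> n - 1" using j by linarith
    then show ?thesis
    proof cases
      case 3
      then show ?thesis using corner mono1[of 1 j] mono1[of j "n - 1"] by auto
    qed (use ht_cornerD[OF c, of 1] \<open>n \<ge> 4\<close> in auto)
  qed
  have mono2: "c i 1 \<le> c i' 1" if "1 \<le> i" "i \<le> i'" "i' \<le> n - 1" for i i'
    using that(2,3)
  proof (induction i' rule: dec_induct)
    case (step m)
    then have "Suc m \<in> {2..n - 1}" "1 \<in> {1..n - 2}" using that \<open>n \<ge> 4\<close> by auto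
    from row0[OF this] step show ?case by (simp add: row_sum_def)
  qed simp
  \<comment> \<open>The half-turn gives \<open>c (n - 1) 1 = c 1 (n - 1)\<close>, so the single
    upper bound in the first row also caps the first column.\<close>
  have "c (n - 1) 1 \<le> 1"
    using corner(2) ht_corner_rotate[OF c, of 1 "n - 1"] \<open>n \<ge> 4\<close> by (simp add: of_nat_diff)
  then have first_col: "c i 1 \<in> {0..1}" if i: "i \<le> n" for i
  proof -
    consider "i = 0" | "i = n" | "1 \<le> i" "i \<le> n - 1" using i by linarith
    then show ?thesis
    proof cases
      case 3
      then show ?thesis using corner mono2[of 1 i] mono2[of i "n - 1"] \<open>c (n - 1) 1 \<le> 1\<close> by auto
    qed (use ht_cornerD[OF c, of 1] \<open>n \<ge> 4\<close> in auto)
  qed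
  have row_1: "row_sum c 1 j \<in> {0..1}" if "j \<le> n" for j
    using first_row[OF that] ht_cornerD(2)[OF c that] by (simp add: row_sum_def)
  have col_1: "col_sum c i 1 \<in> {0..1}" if "i \<le> n" for i
    using first_col[OF that] ht_cornerD(1)[OF c that] by (simp add: col_sum_def)
  have row_le: "row_sum c i j \<le> 1" if ij: "i \<in> {1..n}" "j \<le> n" for i j
  proof -
    consider "i = 1" | "i = n" | "j = 0" | "j = n" | "j = 1" | "2 \<le> i" "i \<le> n - 1" "2 \<le> j" "j \<le> n - 1"
      using ij unfolding atLeastAtMost_iff by linarith
    then show ?thesis
    proof cases
      case 2
      then show ?thesis using row_1[of "n - j"] rot[of 1 "n - j"] that \<open>n \<ge> 4\<close> by simp
    next
      case 5
      \<comment> \<open>In the first column the partial row sum is a difference of two corner sums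
        between 0 and 1, hence at most 1.\<close>
      have "i \<le> n" "i - 1 \<le> n" using ij by auto
      from this[THEN first_col] 5 show ?thesis by (simp add: row_sum_def)
    qed (use row_1 row1 row_sum_trivial[OF c] that in auto)
  qed
  have col_le: "col_sum c i j \<le> 1" if ij: "i \<le> n" "j \<in> {1..n}" for i j
  proof -
    consider "j = 1" | "j = n" | "i = 0" | "i = n" | "i = 1" | "2 \<le> i" "i \<le> n - 1" "2 \<le> j" "j \<le> n - 1"
      using ij unfolding atLeastAtMost_iff by linarith
    then show ?thesis
    proof cases
      case 2
      then show ?thesis using col_1[of "n - i"] rot'[of "n - i" 1] that \<open>n \<ge> 4\<close> by simp
    next
      case 5
      have "j \<le> n" "j - 1 \<le> n" using ij by auto
      from this[THEN first_row] 5 show ?thesis by (simp add: col_sum_def)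
    next
      case 6
      then have "n - i \<in> {1..n - 2}" "n + 1 - j \<in> {2..n - 1}" by auto
      from col0[OF this] show ?thesis using rot'[of i j] that by auto
    qed (use col_1 col_sum_trivial[OF c] that in auto)
  qed
  have "row_sum c i j \<ge> 0" if "i \<in> {1..n}" "j \<le> n" for i j
  proof -
    have "n + 1 - i \<in> {1..n}" "n - j \<le> n" using that by auto
    from row_le[OF this] show ?thesis using rot[of i j] that by auto
  qed
  moreover have "col_sum c i j \<ge> 0" if "i \<le> n" "j \<in> {1..n}" for i j
  proof -
    have "n - i \<le> n" "n + 1 - j \<in> {1..n}" using that by auto
    from col_le[OF this] show ?thesis using rot'[of i j] that by auto
  qed
  ultimately show ?thesis
    using row_le col_le by (simp add: feasible_def)
qed

subsection \<open>Integrality of the extreme points\<close>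

text \<open>Provides one step length that fits all finitely many partial sums with values strictly
  between 0 and 1, in both directions.\<close>

lemma finite_unit_gap:
  fixes D :: "real set"
  assumes "finite D"
  shows "\<exists>\<epsilon>>0. \<forall>d\<in>D. 0 < d \<and> d < 1 \<longrightarrow> \<epsilon> \<le> d \<and> d \<le> 1 - \<epsilon>"
  using assms
proof induction
  case empty
  then show ?case by (auto intro: exI[of _ 1])
next
  case (insert x D)
  then obtain \<epsilon> where "\<epsilon> > 0" "\<forall>d\<in>D. 0 < d \<and> d < 1 \<longrightarrow> \<epsilon> \<le> d \<and> d \<le> 1 - \<epsilon>" by blast
  then show ?case
    by (intro exI[of _ "if 0 < x \<and> x < 1 then min \<epsilon> (min x (1 - x)) else \<epsilon>"]) fastforce
qed

text \<open>Shifting simultaneously all corner sums with one fixed fractional part preserves feasibility,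
  because a difference of two corner sums that is affected by the shift is not an integer.\<close>

lemma feasible_shift_fractional_class:
  assumes c: "ht_corner n c" "feasible n c" and x: "x \<notin> \<int>"
  defines "\<phi> \<equiv> \<lambda>u v. of_bool (c u v - x \<in> \<int>)"
  obtains \<epsilon> where "\<epsilon> > 0"
    "\<And>\<sigma>. \<bar>\<sigma>\<bar> = \<epsilon> \<Longrightarrow> ht_corner n (\<lambda>u v. c u v + \<sigma> * \<phi> u v) \<and> feasible n (\<lambda>u v. c u v + \<sigma> * \<phi> u v)"
proof -
  define D where "D = (\<lambda>(i, j). row_sum c i j) ` ({..n} \<times> {..n}) \<union> (\<lambda>(i, j). col_sum c i j) ` ({..n} \<times> {..n})"
  have "finite D" by (simp add: D_def)
  then obtain \<epsilon> where \<epsilon>: "\<epsilon> > 0" "\<And>d. d \<in> D \<Longrightarrow> 0 < d \<Longrightarrow> d < 1 \<Longrightarrow> \<epsilon> \<le> d \<and> d \<le> 1 - \<epsilon>"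
    using finite_unit_gap by blast
  \<comment> \<open>Boundary corner sums are integers, so none of them shares the fractional part of
    the non-integral \<open>x\<close>; the shift leaves the boundary alone.\<close>
  have nat_x: "real m - x \<notin> \<int>" for m
    using x by (metis Ints_diff Ints_of_nat diff_diff_eq2 add_diff_cancel_left')
  have Ints_shift: "a + of_int m \<in> \<int> \<longleftrightarrow> a \<in> \<int>" for a :: real and m
    by (metis Ints_add Ints_diff Ints_of_int add_diff_cancel_right')
  have "\<phi> (n - u) (n - v) = \<phi> u v" if "u \<le> n" "v \<le> n" for u v
  proof -
    have eq: "c (n - u) (n - v) - x = (c u v - x) + of_int (int n - int u - int v)"
      using ht_corner_rotate[OF c(1) that] by simp
    show ?thesis
      unfolding \<phi>_def eq Ints_shift ..
  qed
  moreover have "\<phi> u 0 = 0" "\<phi> 0 u = 0" "\<phi> u n = 0" "\<phi> n u = 0" if "u \<le> n" for u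
    using nat_x[of 0] nat_x[of u] ht_cornerD[OF c(1) that] by (simp_all add: \<phi>_def)
  ultimately have ht: "ht_corner n (\<lambda>u v. c u v + \<sigma> * \<phi> u v)" for \<sigma>
    using c(1) by (simp add: ht_corner_def)
  have step: "d + \<sigma> * (p - q) \<in> {0..1}"
    if "d \<in> {0..1}" "d \<in> D" "\<bar>\<sigma>\<bar> = \<epsilon>" "p = of_bool (a - x \<in> \<int>)" "q = of_bool (b - x \<in> \<int>)" "d = a - b"
    for d p q a b \<sigma> :: real
  proof (cases "p = q")
    case False
    have "d \<notin> \<int>"
    proof
      assume "d \<in> \<int>"
      moreover have "a - x = d + (b - x)" "b - x = (a - x) - d" using that(6) by auto
      ultimately have "a - x \<in> \<int> \<longleftrightarrow> b - x \<in> \<int>" by (metis Ints_add Ints_diff)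
      with False that show False by simp
    qed
    then have "d \<noteq> 0" "d \<noteq> 1" by auto
    then have "\<epsilon> \<le> d" "d \<le> 1 - \<epsilon>" using \<epsilon>(2)[of d] that by auto
    moreover have "p - q = 1 \<or> p - q = -1" using False that(4,5) by auto
    ultimately show ?thesis using that(3) by (auto simp: abs_real_def split: if_splits)
  qed (use that in auto)
  have "feasible n (\<lambda>u v. c u v + \<sigma> * \<phi> u v)" if "\<bar>\<sigma>\<bar> = \<epsilon>" for \<sigma>
    unfolding feasible_def
  proof (intro conjI ballI allI impI)
    fix i j assume ij: "i \<in> {1..n}" "j \<le> n"
    then have "row_sum c i j \<in> {0..1}" "row_sum c i j \<in> D"
      using c(2) by (auto simp: feasible_def D_def)
    from step[OF this that refl refl row_sum_def]
    show "row_sum (\<lambda>u v. c u v + \<sigma> * \<phi> u v) i j \<in> {0..1}"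
      unfolding row_sum_def \<phi>_def by (simp add: algebra_simps)
  next
    fix i j assume ij: "i \<le> n" "j \<in> {1..n}"
    then have "col_sum c i j \<in> {0..1}" "col_sum c i j \<in> D"
      using c(2) by (auto simp: feasible_def D_def)
    from step[OF this that refl refl col_sum_def]
    show "col_sum (\<lambda>u v. c u v + \<sigma> * \<phi> u v) i j \<in> {0..1}"
      unfolding col_sum_def \<phi>_def by (simp add: algebra_simps)
  qed
  with that[OF \<epsilon>(1)] ht show ?thesis by blast
qed

section \<open>The core polytope as the solution set of the listed inequalities\<close>

locale htsasm_core =
  fixes n :: nat and idx :: "'c::finite \<Rightarrow> nat \<times> nat"
  assumes n4: "n \<ge> 4" and idx: "bij_betw idx UNIV (core_positions n)"
begin

definition core_point :: "(nat \<Rightarrow> nat \<Rightarrow> real) \<Rightarrow> real ^ 'c" where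
  "core_point c = core idx (entry c)"

lemma idx_bounds:
  assumes "idx p = (i, j)"
  shows "i \<in> {1..n}" "j \<in> {1..n}"
proof -
  have "(i, j) \<in> core_positions n" using idx assms by (metis bij_betwE UNIV_I)
  then show "i \<in> {1..n}" "j \<in> {1..n}" using n4 by (auto simp: core_positions_def split: if_splits)
qed

lemma core_entry_core_point:
  assumes "(i, j) \<in> core_positions n"
  shows "core_entry idx (core_point c) i j = entry c i j"
proof -
  have "idx (inv idx (i, j)) = (i, j)"
    using idx assms by (metis bij_betw_imp_surj_on f_inv_into_f)
  then show ?thesis by (simp add: core_entry_def core_point_def core_def)
qed

text \<open>Positions of row \<open>i\<close> to the right of the core are carried by the half-turn
  into the left part of row \<open>n + 1 - i\<close>, which belongs to the core; the two sums of
  \<open>eval_sum\<close> thus join to one initial segment of row \<open>i\<close>.\<close>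

lemma eval_sum_R:
  assumes c: "ht_corner n c" and i: "1 \<le> i" "i \<le> n div 2" and j: "j \<le> n"
  shows "eval_sum n idx (R i j) (core_point c) = row_sum c i j"
proof -
  define l where "l = (n + 1) div 2"
  have l: "l \<le> n" "n - l = n div 2" by (auto simp: l_def)
  have "(\<Sum>j'=1..min l j. core_entry idx (core_point c) i j') = (\<Sum>j'=1..min l j. entry c i j')"
    using i by (intro sum.cong refl core_entry_core_point) (auto simp: core_positions_def l_def)
  moreover have "(\<Sum>j'=l+1..j. core_entry idx (core_point c) (n + 1 - i) (n + 1 - j')) = (\<Sum>j'=l+1..j. entry c i j')"
  proof (intro sum.cong refl)
    fix j' assume j': "j' \<in> {l + 1..j}"
    then have "(n + 1 - i, n + 1 - j') \<in> core_positions n"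
      using i j l by (auto simp: core_positions_def)
    then show "core_entry idx (core_point c) (n + 1 - i) (n + 1 - j') = entry c i j'"
      using entry_rotate[OF c, of i j'] i j j' by (simp add: core_entry_core_point)
  qed
  moreover have "(\<Sum>j'=1..min l j. entry c i j') + (\<Sum>j'=l+1..j. entry c i j') = (\<Sum>j'=1..j. entry c i j')"
  proof (cases "l \<le> j")
    case True
    then show ?thesis by (metis add.commute le_add2 le_add_diff_inverse min.absorb1 sum.ub_add_nat)
  qed simp
  moreover have "(\<Sum>j'=1..j. entry c i j') = row_sum c i j"
    using sum_entry_row[OF c] i by simp
  ultimately show ?thesis by (simp add: l_def)
qed

lemma eval_sum_facet:
  assumes c: "ht_corner n c" and e: "e \<in> facet_equations n"
  shows "eval_sum n idx (fst e) (core_point c) = corner_value n c (fst e)"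
proof -
  have K: "eval_sum n idx (K i j) (core_point c) = col_sum c i j" if "i \<le> n" "1 \<le> j" "j \<le> n div 2" for i j
  proof -
    have "(\<Sum>i'=1..i. core_entry idx (core_point c) i' j) = (\<Sum>i'=1..i. entry c i' j)"
      using that by (intro sum.cong refl core_entry_core_point) (auto simp: core_positions_def)
    then show ?thesis using sum_entry_col[OF c, of j i] that by simp
  qed
  have M: "eval_sum n idx (M j) (core_point c) = row_sum c ((n + 1) div 2) j" if "odd n" "j \<le> n div 2" for j
  proof -
    have "(\<Sum>j'=1..j. core_entry idx (core_point c) ((n + 1) div 2) j') = (\<Sum>j'=1..j. entry c ((n + 1) div 2) j')"
      using that n4 by (intro sum.cong refl core_entry_core_point) (auto simp: core_positions_def)
    then show ?thesis using sum_entry_row[OF c, of "(n + 1) div 2" j] that n4 by simp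
  qed
  have N: "eval_sum n idx (N i) (core_point c) = col_sum c i ((n + 1) div 2)" if "odd n" "i \<le> n div 2" for i
  proof -
    have "(\<Sum>i'=1..i. core_entry idx (core_point c) i' ((n + 1) div 2)) = (\<Sum>i'=1..i. entry c i' ((n + 1) div 2))"
      using that n4 by (intro sum.cong refl core_entry_core_point) (auto simp: core_positions_def)
    then show ?thesis using sum_entry_col[OF c, of "(n + 1) div 2" i] that n4 by simp
  qed
  have "1 \<le> n div 2" using n4 by simp
  from e show ?thesis
    by (cases rule: facet_equationsE) (use n4 eval_sum_R[OF c] K M N in \<open>simp_all del: eval_sum.simps One_nat_def\<close>)
qed

text \<open>The \<open>R\<close> sums recover the corner sums of the upper half row by row from the
  core, and the half-turn recovers the rest. Injectivity is what makes two different shifts give two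
  different points.\<close>

lemma corner_eq_if_core_point_eq:
  assumes c: "ht_corner n c" and d: "ht_corner n d" and eq: "core_point c = core_point d"
    and "u \<le> n" "v \<le> n"
  shows "c u v = d u v"
proof -
  have top: "c u v = d u v" if "u \<le> n div 2" "v \<le> n" for u v
    using that
  proof (induction u)
    case 0
    then show ?case using ht_cornerD[OF c, of v] ht_cornerD[OF d, of v] by simp
  next
    case (Suc u)
    have "row_sum c (Suc u) v = row_sum d (Suc u) v"
      using eval_sum_R[OF c, of "Suc u" v] eval_sum_R[OF d, of "Suc u" v] eq Suc.prems by simp
    with Suc show ?case by (simp add: row_sum_def)
  qed
  show ?thesis
  proof (cases "u \<le> n div 2")
    case False
    then have "n - u \<le> n div 2" by linarith
    then show ?thesis
      using top[of "n - u" "n - v"] ht_corner_rotate[OF c assms(4,5)] ht_corner_rotate[OF d assms(4,5)] by simp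
  qed (use top assms in blast)
qed

lemma core_point_combine:
  "core_point (\<lambda>u v. a * c u v + b * d u v) = a *\<^sub>R core_point c + b *\<^sub>R core_point d"
  by (simp add: vec_eq_iff core_point_def core_def entry_def algebra_simps)

text \<open>The affine set relative to which facets are taken. It is a proper subset of the whole
  space: core entries obey, for example, that each of the first \<open>n div 2\<close> columns sums
  to 1.\<close>

definition corner_space :: "(real ^ 'c) set" where
  "corner_space = core_point ` {c. ht_corner n c}"

lemma affine_corner_space: "affine corner_space"
  unfolding affine_def
proof (intro ballI allI impI)
  fix x y a b assume "x \<in> corner_space" "y \<in> corner_space" and ab: "a + b = (1::real)"
  then obtain c d where "ht_corner n c" "x = core_point c" "ht_corner n d" "y = core_point d"
    by (auto simp: corner_space_def)
  with ht_corner_combine[of n c d a b] ab show "a *\<^sub>R x + b *\<^sub>R y \<in> corner_space"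
    unfolding corner_space_def core_point_combine[symmetric] 
    by (intro image_eqI[where x = "\<lambda>u v. a * c u v + b * d u v"]) (simp_all add: core_point_combine)
qed

definition facet_polyhedron :: "(real ^ 'c) set" where
  "facet_polyhedron = corner_space \<inter> {x. \<forall>e\<in>facet_equations n. signed_sum n idx e x \<le> snd e}"

lemma facet_inequality_iff:
  assumes "ht_corner n c" "(L, b) \<in> facet_equations n"
  shows "b = 0 \<and> signed_sum n idx (L, b) (core_point c) = - corner_value n c L \<or>
    b = 1 \<and> signed_sum n idx (L, b) (core_point c) = corner_value n c L"
proof -
  have "b \<in> {0, 1}" using assms(2) by (cases L) (auto simp: mem_facet_equations)
  then show ?thesis using eval_sum_facet[OF assms] by (auto simp: signed_sum_def)
qed

lemma facet_polyhedron_iff_feasible: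
  assumes c: "ht_corner n c"
  shows "core_point c \<in> facet_polyhedron \<longleftrightarrow> feasible n c"
proof -
  have "core_point c \<in> facet_polyhedron \<longleftrightarrow>
      (\<forall>(L, b)\<in>facet_equations n. signed_sum n idx (L, b) (core_point c) \<le> b)"
    using c by (auto simp: facet_polyhedron_def corner_space_def)
  also have "\<dots> \<longleftrightarrow> feasible n c"
  proof
    assume *: "\<forall>(L, b)\<in>facet_equations n. signed_sum n idx (L, b) (core_point c) \<le> b"
    show "feasible n c"
    proof (rule feasible_if_facet_inequalities[OF c n4])
      fix L
      show "(L, 0) \<in> facet_equations n \<Longrightarrow> corner_value n c L \<ge> 0"
        using * facet_inequality_iff[OF c, of L 0] by fastforce
      show "(L, 1) \<in> facet_equations n \<Longrightarrow> corner_value n c L \<le> 1"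
        using * facet_inequality_iff[OF c, of L 1] by fastforce
    qed
  next
    assume "feasible n c"
    then show "\<forall>(L, b)\<in>facet_equations n. signed_sum n idx (L, b) (core_point c) \<le> b"
      using feasible_corner_value[of n c] facet_inequality_iff[OF c] n4 by fastforce
  qed
  finally show ?thesis .
qed

lemma compact_facet_polyhedron: "compact facet_polyhedron"
  unfolding compact_eq_bounded_closed
proof
  have "norm x \<le> real CARD('c)" if "x \<in> facet_polyhedron" for x
  proof -
    from that obtain c where c: "ht_corner n c" "x = core_point c"
      by (auto simp: facet_polyhedron_def corner_space_def)
    then have f: "feasible n c" using that facet_polyhedron_iff_feasible by blast
    have "\<bar>x $ p\<bar> \<le> 1" for p
    proof -
      obtain i j where ij: "idx p = (i, j)" by fastforce
      have "row_sum c i j \<in> {0..1}" "row_sum c i (j - 1) \<in> {0..1}"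
        using f idx_bounds[OF ij] unfolding feasible_def by auto
      then show ?thesis
        using ij c(2) by (auto simp: core_point_def core_def entry_conv_row_sum)
    qed
    then have "(\<Sum>p\<in>UNIV. \<bar>x $ p\<bar>) \<le> (\<Sum>p\<in>(UNIV::'c set). 1)" by (intro sum_mono)
    then show ?thesis using norm_le_l1_cart[of x] by simp
  qed
  then show "bounded facet_polyhedron" by (rule boundedI)
  have "closed {x. signed_sum n idx e x \<le> b}" for e b
    by (intro closed_Collect_le continuous_on_const linear_continuous_on
        linear_conv_bounded_linear[THEN iffD1] linear_signed_sum)
  then have "closed (\<Inter>e\<in>facet_equations n. {x. signed_sum n idx e x \<le> snd e})"
    by blast
  moreover have "(\<Inter>e\<in>facet_equations n. {x. signed_sum n idx e x \<le> snd e}) =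
      {x. \<forall>e\<in>facet_equations n. signed_sum n idx e x \<le> snd e}"
    by auto
  ultimately have "closed {x. \<forall>e\<in>facet_equations n. signed_sum n idx e x \<le> snd e}"
    by (simp only:)
  then show "closed facet_polyhedron"
    unfolding facet_polyhedron_def by (rule closed_Int[OF affine_closed[OF affine_corner_space]])
qed

lemma convex_facet_polyhedron: "convex facet_polyhedron"
proof -
  have "convex {x. signed_sum n idx e x \<le> b}" for e b
    using convex_linear_vimage[OF linear_signed_sum convex_real_interval(2), of n idx e b]
    by (simp add: vimage_def)
  then have "convex (\<Inter>e\<in>facet_equations n. {x. signed_sum n idx e x \<le> snd e})"
    by (intro convex_INT)
  moreover have "(\<Inter>e\<in>facet_equations n. {x. signed_sum n idx e x \<le> snd e}) =
    {x. \<forall>e\<in>facet_equations n. signed_sum n idx e x \<le> snd e}" by auto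
  ultimately have "convex {x. \<forall>e\<in>facet_equations n. signed_sum n idx e x \<le> snd e}"
    by (simp only:)
  then show ?thesis
    unfolding facet_polyhedron_def by (rule convex_Int[OF affine_imp_convex[OF affine_corner_space]])
qed

text \<open>A non-integral corner sum would let its fractional class be shifted by
  \<open>\<epsilon>\<close> both ways, exhibiting \<open>x\<close> as the midpoint of two distinct
  points of the polyhedron.\<close>

lemma extreme_point_facet_polyhedron:
  assumes "x extreme_point_of facet_polyhedron"
  shows "x \<in> core idx ` {X. is_HTSASM n X}"
proof -
  from assms have x: "x \<in> facet_polyhedron"
    and ext: "\<And>a b. a \<in> facet_polyhedron \<Longrightarrow> b \<in> facet_polyhedron \<Longrightarrow> x \<notin> open_segment a b"
    by (auto simp: extreme_point_of_def)
  then obtain c where c: "ht_corner n c" "x = core_point c"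
    by (auto simp: facet_polyhedron_def corner_space_def)
  then have f: "feasible n c" using x facet_polyhedron_iff_feasible by blast
  have "c u v \<in> \<int>" if uv: "u \<le> n" "v \<le> n" for u v
  proof (rule ccontr)
    assume "c u v \<notin> \<int>"
    define \<phi> :: "nat \<Rightarrow> nat \<Rightarrow> real" where "\<phi> = (\<lambda>u' v'. of_bool (c u' v' - c u v \<in> \<int>))"
    from feasible_shift_fractional_class[OF c(1) f \<open>c u v \<notin> \<int>\<close>]
    obtain \<epsilon> where "\<epsilon> > 0" and \<epsilon>:
      "\<And>\<sigma>. \<bar>\<sigma>\<bar> = \<epsilon> \<Longrightarrow> ht_corner n (\<lambda>u v. c u v + \<sigma> * \<phi> u v) \<and> feasible n (\<lambda>u v. c u v + \<sigma> * \<phi> u v)"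
      unfolding \<phi>_def by blast
    let ?p = "core_point (\<lambda>u v. c u v + \<epsilon> * \<phi> u v)" and ?m = "core_point (\<lambda>u v. c u v + (-\<epsilon>) * \<phi> u v)"
    have pm: "?p \<in> facet_polyhedron" "?m \<in> facet_polyhedron"
      using \<epsilon>[of \<epsilon>] \<epsilon>[of "-\<epsilon>"] \<open>\<epsilon> > 0\<close> facet_polyhedron_iff_feasible by auto
    \<comment> \<open>The class contains \<open>(u, v)\<close> itself, so
      \<open>\<phi> u v = 1\<close> and the two shifts differ there.\<close>
    have "?p \<noteq> ?m"
    proof
      assume "?p = ?m"
      with \<epsilon>[of \<epsilon>] \<epsilon>[of "-\<epsilon>"] \<open>\<epsilon> > 0\<close> have "c u v + \<epsilon> * \<phi> u v = c u v + (-\<epsilon>) * \<phi> u v"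
        by (intro corner_eq_if_core_point_eq[OF _ _ _ uv]) auto
      then show False using \<open>\<epsilon> > 0\<close> by (simp add: \<phi>_def)
    qed
    moreover have "x = midpoint ?p ?m"
      unfolding c(2) midpoint_def
      by (simp add: vec_eq_iff core_point_def core_def entry_def algebra_simps)
    ultimately show False using ext[OF pm] by simp
  qed
  then have "is_HTSASM n (entry c)" using HTSASM_entry[OF c(1) f] by blast
  then show ?thesis using c(2) by (auto simp: core_point_def)
qed

lemma HTSASM_core_polytope_eq: "HTSASM_core_polytope n idx = facet_polyhedron"
proof
  have "core idx X \<in> facet_polyhedron" if "is_HTSASM n X" for X
  proof -
    have "core idx X = core_point (corner_sum X)"
      unfolding core_point_def core_def vec_eq_iff
    proof
      fix p
      obtain i j where ij: "idx p = (i, j)" by fastforce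
      from idx_bounds[OF ij] show
        "(\<chi> p. X (fst (idx p)) (snd (idx p))) $ p =
         (\<chi> p. entry (corner_sum X) (fst (idx p)) (snd (idx p))) $ p"
        by (simp add: ij entry_corner_sum)
    qed
    then show ?thesis
      using ht_corner_corner_sum[OF that] facet_polyhedron_iff_feasible by simp
  qed
  then show "HTSASM_core_polytope n idx \<subseteq> facet_polyhedron"
    unfolding HTSASM_core_polytope_def
    by (intro hull_minimal convex_facet_polyhedron) auto
  have "facet_polyhedron = convex hull {x. x extreme_point_of facet_polyhedron}"
    by (rule Krein_Milman_Minkowski[OF compact_facet_polyhedron convex_facet_polyhedron])
  also have "\<dots> \<subseteq> HTSASM_core_polytope n idx"
    unfolding HTSASM_core_polytope_def
    using extreme_point_facet_polyhedron by (intro hull_mono) blast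
  finally show "facet_polyhedron \<subseteq> HTSASM_core_polytope n idx" .
qed

end

subsection \<open>Points violating a single inequality\<close>

text \<open>The exempt sets have to hold more than one position: a violation is copied by the
  half-turn, and it may force unlisted bounds to fail as well.\<close>

definition feasible_except ::
  "nat \<Rightarrow> (nat \<Rightarrow> nat \<Rightarrow> real) \<Rightarrow> (nat \<times> nat) set \<Rightarrow> (nat \<times> nat) set \<Rightarrow> bool" where
  "feasible_except n c S T \<longleftrightarrow>
     (\<forall>i\<in>{1..n}. \<forall>j\<le>n. (i, j) \<notin> S \<longrightarrow> row_sum c i j \<in> {0..1}) \<and>
     (\<forall>i\<le>n. \<forall>j\<in>{1..n}. (i, j) \<notin> T \<longrightarrow> col_sum c i j \<in> {0..1})"

definition shift_at :: "nat \<Rightarrow> nat \<Rightarrow> nat \<Rightarrow> real \<Rightarrow> (nat \<Rightarrow> nat \<Rightarrow> real) \<Rightarrow> nat \<Rightarrow> nat \<Rightarrow> real" where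
  "shift_at n p q t c u v = c u v + t * of_bool (u = p \<and> v = q \<or> u = n - p \<and> v = n - q)"

lemma ht_corner_shift_at:
  assumes "ht_corner n c" "p \<in> {1..n - 1}" "q \<in> {1..n - 1}"
  shows "ht_corner n (shift_at n p q t c)"
proof -
  have "n - u = p \<and> n - v = q \<or> n - u = n - p \<and> n - v = n - q \<longleftrightarrow>
      u = p \<and> v = q \<or> u = n - p \<and> v = n - q" if "u \<le> n" "v \<le> n" for u v
    using that assms(2,3) by auto
  then have "shift_at n p q t c (n - u) (n - v) = real n - real u - real v + shift_at n p q t c u v"
    if "u \<le> n" "v \<le> n" for u v
    using ht_corner_rotate[OF assms(1) that] that by (simp add: shift_at_def)
  moreover have "p \<noteq> 0" "q \<noteq> 0" "p \<noteq> n" "q \<noteq> n" "n - p \<noteq> 0" "n - q \<noteq> 0" "n - p \<noteq> n" "n - q \<noteq> n"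
    using assms(2,3) by auto
  ultimately show ?thesis
    using ht_cornerD[OF assms(1)] by (simp add: ht_corner_def shift_at_def)
qed

text \<open>Since \<open>2 * p < n\<close>, the two shifted corner sums lie in different rows, so no
  column sum feels both of them.\<close>

lemma shift_at_steps:
  assumes "2 * p < n" "p \<ge> 1" "q \<in> {1..n - 1}"
  shows "row_sum (shift_at n p q t c) p q = row_sum c p q + t"
    "row_sum (shift_at n p q t c) (p + 1) q = row_sum c (p + 1) q - t"
    "col_sum (shift_at n p q t c) p q = col_sum c p q + t"
    "col_sum (shift_at n p q t c) p (q + 1) = col_sum c p (q + 1) - t"
proof -
  \<comment> \<open>If both shifted positions bounded the same row step, the changes would cancel.
    That would require \<open>n = 2 * p + 1\<close> and \<open>n = 2 * q\<close>, which parity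
    excludes.\<close>
  have "\<not> (p + 1 = n - p \<and> q = n - q)" using assms by presburger
  then show "row_sum (shift_at n p q t c) (p + 1) q = row_sum c (p + 1) q - t"
    using assms by (auto simp: row_sum_def shift_at_def)
qed (use assms in \<open>auto simp: row_sum_def col_sum_def shift_at_def\<close>)

text \<open>Only the four partial sums through \<open>(p, q)\<close> and their half-turn images
  change. The images are complements to 1, so with \<open>S\<close> and \<open>T\<close> closed
  under the half-turn four conditions suffice.\<close>

lemma feasible_except_shift_at:
  assumes c: "ht_corner n c" "feasible n c"
    and pq: "2 * p < n" "p \<ge> 1" "q \<in> {1..n - 1}"
    and S: "\<And>i j. (i, j) \<in> S \<Longrightarrow> (n + 1 - i, n - j) \<in> S"
    and T: "\<And>i j. (i, j) \<in> T \<Longrightarrow> (n - i, n + 1 - j) \<in> T"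
    and row: "(p, q) \<notin> S \<Longrightarrow> row_sum c p q + t \<in> {0..1}"
      "(p + 1, q) \<notin> S \<Longrightarrow> row_sum c (p + 1) q - t \<in> {0..1}"
    and col: "(p, q) \<notin> T \<Longrightarrow> col_sum c p q + t \<in> {0..1}"
      "(p, q + 1) \<notin> T \<Longrightarrow> col_sum c p (q + 1) - t \<in> {0..1}"
  shows "feasible_except n (shift_at n p q t c) S T"
proof -
  let ?z = "shift_at n p q t c"
  have z: "ht_corner n ?z" using ht_corner_shift_at[OF c(1), of p q] pq by auto
  have "row_sum ?z i j \<in> {0..1}" if ij: "i \<in> {1..n}" "j \<le> n" "(i, j) \<notin> S" for i j
  proof -
    have step: "i - 1 = p \<longleftrightarrow> i = p + 1" "i - 1 = n - p \<longleftrightarrow> i = n + 1 - p"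
      using ij pq by auto
    consider "i = p \<and> j = q" | "i = p + 1 \<and> j = q" | "i = n + 1 - p \<and> j = n - q" | "i = n - p \<and> j = n - q"
      | "\<not> (i = p \<and> j = q)" "\<not> (i - 1 = p \<and> j = q)" "\<not> (i = n - p \<and> j = n - q)"
        "\<not> (i - 1 = n - p \<and> j = n - q)"
      unfolding step by blast
    then show ?thesis
    proof cases
      case 3
      then have "(p, q) \<notin> S" using S[of p q] ij by auto
      moreover have "row_sum ?z i j = 1 - row_sum ?z p q"
        using row_sum_rotate[OF z, of p q] 3 pq by auto
      ultimately show ?thesis using row(1) shift_at_steps(1)[OF pq] by simp
    next
      case 4
      then have "(p + 1, q) \<notin> S" using S[of "p + 1" q] ij by auto
      moreover have "row_sum ?z i j = 1 - row_sum ?z (p + 1) q"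
        using row_sum_rotate[OF z, of "p + 1" q] 4 pq by auto
      ultimately show ?thesis using row(2) shift_at_steps(2)[OF pq] by simp
    next
      case 5
      then have "?z i j = c i j" "?z (i - 1) j = c (i - 1) j" by (auto simp: shift_at_def)
      then have "row_sum ?z i j = row_sum c i j" by (simp add: row_sum_def)
      then show ?thesis using c(2) ij by (simp add: feasible_def)
    qed (use row ij shift_at_steps(1,2)[OF pq] in auto)
  qed
  moreover have "col_sum ?z i j \<in> {0..1}" if ij: "i \<le> n" "j \<in> {1..n}" "(i, j) \<notin> T" for i j
  proof -
    have step: "j - 1 = q \<longleftrightarrow> j = q + 1" "j - 1 = n - q \<longleftrightarrow> j = n + 1 - q"
      using ij pq by auto
    consider "i = p \<and> j = q" | "i = p \<and> j = q + 1" | "i = n - p \<and> j = n + 1 - q" | "i = n - p \<and> j = n - q"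
      | "\<not> (i = p \<and> j = q)" "\<not> (i = p \<and> j - 1 = q)" "\<not> (i = n - p \<and> j = n - q)"
        "\<not> (i = n - p \<and> j - 1 = n - q)"
      unfolding step by blast
    then show ?thesis
    proof cases
      case 3
      then have "(p, q) \<notin> T" using T[of p q] ij by auto
      moreover have "col_sum ?z i j = 1 - col_sum ?z p q"
        using col_sum_rotate[OF z, of p q] 3 pq by auto
      ultimately show ?thesis using col(1) shift_at_steps(3)[OF pq] by simp
    next
      case 4
      then have "(p, q + 1) \<notin> T" using T[of p "q + 1"] ij by auto
      moreover have "col_sum ?z i j = 1 - col_sum ?z p (q + 1)"
        using col_sum_rotate[OF z, of p "q + 1"] 4 pq by auto
      ultimately show ?thesis using col(2) shift_at_steps(4)[OF pq] by simp
    next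
      case 5
      then have "?z i j = c i j" "?z i (j - 1) = c i (j - 1)" by (auto simp: shift_at_def)
      then have "col_sum ?z i j = col_sum c i j" by (simp add: col_sum_def)
      then show ?thesis using c(2) ij by (simp add: feasible_def)
    qed (use col ij shift_at_steps(3,4)[OF pq] in auto)
  qed
  ultimately show ?thesis by (simp add: feasible_except_def)
qed

text \<open>The corner sums of the matrix with its columns in reverse order: the first
  \<open>v\<close> columns are then the old last ones, and each row sums to 1. Prefixes become
  suffixes, which exchanges lower and upper bounds on row sums.\<close>

definition reflect :: "nat \<Rightarrow> (nat \<Rightarrow> nat \<Rightarrow> real) \<Rightarrow> nat \<Rightarrow> nat \<Rightarrow> real" where
  "reflect n c u v = real u - c u (n - v)"

lemma row_sum_reflect: "1 \<le> i \<Longrightarrow> row_sum (reflect n c) i j = 1 - row_sum c i (n - j)"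
  by (simp add: row_sum_def reflect_def of_nat_diff)

lemma col_sum_reflect: "j \<in> {1..n} \<Longrightarrow> col_sum (reflect n c) i j = col_sum c i (n + 1 - j)"
  by (simp add: col_sum_def reflect_def Suc_diff_le)

lemma ht_corner_reflect:
  assumes "ht_corner n c"
  shows "ht_corner n (reflect n c)"
proof -
  have "reflect n c (n - u) (n - v) = real n - real u - real v + reflect n c u v" if "u \<le> n" "v \<le> n" for u v
    using ht_corner_rotate[OF assms, of u "n - v"] that by (simp add: reflect_def of_nat_diff)
  then show ?thesis
    using ht_cornerD[OF assms] unfolding ht_corner_def by (simp add: reflect_def of_nat_diff)
qed

lemma feasible_except_reflect:
  assumes "feasible_except n c S T"
  shows "feasible_except n (reflect n c) {(i, j). (i, n - j) \<in> S} {(i, j). (i, n + 1 - j) \<in> T}"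
  unfolding feasible_except_def
proof (intro conjI ballI allI impI)
  fix i j assume "i \<in> {1..n}" "j \<le> n" "(i, j) \<notin> {(i, j). (i, n - j) \<in> S}"
  then have "row_sum c i (n - j) \<in> {0..1}" "1 \<le> i"
    using assms by (simp_all add: feasible_except_def)
  then show "row_sum (reflect n c) i j \<in> {0..1}" by (simp add: row_sum_reflect)
next
  fix i j assume "i \<le> n" "j \<in> {1..n}" "(i, j) \<notin> {(i, j). (i, n + 1 - j) \<in> T}"
  moreover from this have "n + 1 - j \<in> {1..n}" by auto
  ultimately show "col_sum (reflect n c) i j \<in> {0..1}"
    using assms by (simp add: feasible_except_def col_sum_reflect)
qed

lemma ht_corner_transpose: "ht_corner n c \<Longrightarrow> ht_corner n (\<lambda>u v. c v u)"
  by (auto simp: ht_corner_def)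

lemma feasible_except_transpose:
  assumes "feasible_except n c S T"
  shows "feasible_except n (\<lambda>u v. c v u) {(i, j). (j, i) \<in> T} {(i, j). (j, i) \<in> S}"
  using assms by (auto simp: feasible_except_def row_sum_def col_sum_def)

section \<open>Starting points and their shifts\<close>

lemma ht_corner_uniform: "n > 0 \<Longrightarrow> ht_corner n (\<lambda>u v. real u * real v / real n)"
  by (auto simp: ht_corner_def of_nat_diff field_simps)

lemma uniform_steps:
  assumes "n > 0"
  shows "1 \<le> i \<Longrightarrow> row_sum (\<lambda>u v. real u * real v / real n) i j = real j / real n"
    "1 \<le> j \<Longrightarrow> col_sum (\<lambda>u v. real u * real v / real n) i j = real i / real n"
  using assms by (auto simp: row_sum_def col_sum_def of_nat_diff field_simps)

text \<open>Shifting one corner sum affects four partial sums (up to the half-turn). The starting points below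
  are chosen such that all of them except the one to be pushed out of range leave room for the shift.\<close>

lemma violate_row_lower:
  assumes i: "2 \<le> i" "i \<le> n div 2" and j: "1 \<le> j" "j \<le> n - 2"
  obtains z where "ht_corner n z" "row_sum z i j < 0"
    "feasible_except n z {(i, j), (n + 1 - i, n - j)} {}"
proof -
  define i2 where "i2 = n + 1 - i"
  have n: "n \<ge> 4" "i < i2" "i + i2 = n + 1" "i2 < n" using i by (auto simp: i2_def)
  \<comment> \<open>\<open>g u\<close> counts the uniform rows among the first \<open>u\<close>,
    that is, those other than \<open>i\<close> and its image \<open>i2\<close>; \<open>m\<close> is
    the number of uniform rows and also the number of columns over which they spread.\<close>
  define g where "g u = real u - of_bool (i \<le> u) - of_bool (i2 \<le> u)" for u
  define m where "m = real n - 2"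
  have m: "m \<ge> 2" using n by (simp add: m_def)
  text \<open>Row \<open>i\<close> is the last unit vector, row \<open>i2\<close> the first, and the other rows are uniform
    on the columns \<open>2, \<dots>, n - 1\<close>.\<close>
  define c where "c u v = (if v = 0 then 0 else if v = n then real u
      else g u * (real v - 1) / m + of_bool (i2 \<le> u))" for u v
  have g_rot: "g (n - u) = m - g u" if "u \<le> n" for u
    using that i n by (auto simp: g_def m_def of_nat_diff)
  have g_diff: "g u - g (u - 1) = (if u = i \<or> u = i2 then 0 else 1)" if "1 \<le> u" for u
    using that i n by (auto simp: g_def of_nat_diff)
  have g_range: "0 \<le> g u" "g u \<le> m" if "u \<le> n" for u
    using that i n by (auto simp: g_def m_def)
  have "c (n - u) (n - v) = real n - real u - real v + c u v" if uv: "u \<le> n" "v \<le> n" for u v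
  proof -
    consider "v = 0" | "v = n" | "1 \<le> v" "v < n" using uv by linarith
    then show ?thesis
    proof cases
      case 3
      then have "n - v \<noteq> 0" "n - v \<noteq> n" by auto
      then have "c (n - u) (n - v) = (m - g u) * (real (n - v) - 1) / m + of_bool (i2 \<le> n - u)"
        by (simp add: c_def g_rot[OF uv(1)])
      also have "real (n - v) - 1 = m - (real v - 1)" using 3 by (simp add: m_def of_nat_diff)
      also have "(m - g u) * (m - (real v - 1)) / m = m - (real v - 1) - g u + g u * (real v - 1) / m"
        using m by (simp add: field_simps)
      finally show ?thesis using 3 uv n i by (auto simp: c_def g_def m_def)
    qed (use uv n in \<open>auto simp: c_def of_nat_diff\<close>)
  qed
  moreover have "c 0 u = 0 \<and> c n u = real u" if "u \<le> n" for u
    using that i n m g_rot[of 0] by (auto simp: c_def g_def)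
  ultimately have c: "ht_corner n c"
    using n by (auto simp: ht_corner_def c_def)
  have row: "row_sum c u v = (if u = i then 0 else if u = i2 then 1 else (real v - 1) / m)"
    if "1 \<le> u" "1 \<le> v" "v < n" for u v
  proof -
    have "row_sum c u v = (g u - g (u - 1)) * (real v - 1) / m + (of_bool (i2 \<le> u) - of_bool (i2 \<le> u - 1))"
      using that by (simp add: row_sum_def c_def diff_divide_distrib left_diff_distrib)
    then show ?thesis using g_diff[OF that(1)] that n by auto
  qed
  have col: "col_sum c u v = (if v = 1 then of_bool (i2 \<le> u) else if v = n then of_bool (i \<le> u) else g u / m)"
    if v: "1 \<le> v" "v \<le> n" for u v
  proof -
    consider "v = 1" | "v = n" | "2 \<le> v" "v < n" using v by linarith
    then show ?thesis
    proof cases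
      case 2
      have "n - 1 \<noteq> 0" "n - 1 \<noteq> n" "real (n - 1) - 1 = m" using n by (auto simp: m_def)
      then have "c u (n - 1) = g u + of_bool (i2 \<le> u)" using m by (simp add: c_def)
      then show ?thesis using 2 n by (simp add: col_sum_def c_def g_def)
    next
      case 3
      then have "v \<noteq> 0" "v \<noteq> n" "v - 1 \<noteq> 0" "v - 1 \<noteq> n" "real (v - 1) = real v - 1" "v \<noteq> 1" by auto
      then have "col_sum c u v = (g u * (real v - 1) - g u * (real v - 1 - 1)) / m"
        by (simp add: col_sum_def c_def diff_divide_distrib)
      also have "\<dots> = g u / m" by (simp add: algebra_simps)
      finally show ?thesis using 3 by simp
    qed (use n in \<open>simp add: col_sum_def c_def\<close>)
  qed
  have f: "feasible n c"
    unfolding feasible_def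
  proof (intro conjI ballI allI impI)
    fix u v assume uv: "u \<in> {1..n}" "v \<le> n"
    then consider "v = 0" | "v = n" | "1 \<le> v" "v < n" by fastforce
    then show "row_sum c u v \<in> {0..1}"
    proof cases
      case 3
      then have "real v - 1 \<le> m" by (simp add: m_def)
      then show ?thesis using row[of u v] 3 uv m by auto
    qed (use row_sum_trivial[OF c] uv in auto)
  next
    fix u v assume "u \<le> n" "v \<in> {1..n}"
    then show "col_sum c u v \<in> {0..1}" using col[of v u] g_range[of u] m by auto
  qed
  have g_i: "g (i - 1) = real i - 1" using i n by (auto simp: g_def of_nat_diff)
  have "real j \<le> m" "real i \<le> m" using i j n by (auto simp: m_def)
  \<comment> \<open>The shift has the size of one uniform entry and pushes the sum in row
    \<open>i\<close> from 0 to \<open>-1 / m\<close>. The neighbours allow it: the sum in row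
    \<open>i - 1\<close> becomes \<open>j / m\<close>, the one in column \<open>j\<close> at most
    \<open>i / m\<close>, and the one in column \<open>j + 1\<close> becomes
    \<open>(i - 2) / m\<close>; here \<open>2 \<le> i\<close> and \<open>j \<le> n - 2\<close> are
    used.\<close>
  let ?z = "shift_at n (i - 1) j (1 / m) c"
  have p: "2 * (i - 1) < n" "i - 1 \<ge> 1" "j \<in> {1..n - 1}" using i j n by auto
  have "ht_corner n ?z"
    using ht_corner_shift_at[OF c] p by auto
  moreover have "row_sum ?z i j < 0"
    using shift_at_steps(2)[OF p, of "1 / m" c] row[of i j] i j m by simp
  moreover have "feasible_except n ?z {(i, j), (i2, n - j)} {}"
  proof (rule feasible_except_shift_at[OF c f p])
    show "(i', j') \<in> {(i, j), (i2, n - j)} \<Longrightarrow>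
        (n + 1 - i', n - j') \<in> {(i, j), (i2, n - j)}" for i' j'
      using i j n by auto
    show "row_sum c (i - 1) j + 1 / m \<in> {0..1}"
      using row[of "i - 1" j] i j n m \<open>real j \<le> m\<close> by (auto simp: field_simps)
    show "col_sum c (i - 1) j + 1 / m \<in> {0..1}"
      using col[of j "i - 1"] i j n m g_i \<open>real i \<le> m\<close> by (auto simp: field_simps)
    show "col_sum c (i - 1) (j + 1) - 1 / m \<in> {0..1}"
      using col[of "j + 1" "i - 1"] i j n m g_i \<open>real i \<le> m\<close> by (auto simp: field_simps)
  qed (use i in auto)
  ultimately show ?thesis unfolding i2_def by (rule that)
qed

text \<open>Shifting by \<open>- 2 / n\<close> turns the uniform corner value \<open>1 / n\<close>
  into \<open>- 1 / n\<close>, and the two neighbouring sums rise only to \<open>3 / n\<close>. The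
  first column sum at the corner is the same number and turns negative too, but no \<open>K\<close>
  equation concerns column 1.\<close>

lemma violate_corner_entry:
  assumes "n \<ge> 4"
  obtains z where "ht_corner n z" "row_sum z 1 1 < 0"
    "feasible_except n z {(1, 1), (n, n - 1)} {(1, 1), (n - 1, n)}"
proof -
  let ?c = "\<lambda>u v. real u * real v / real n"
  have c: "ht_corner n ?c" using assms ht_corner_uniform[of n] by simp
  note st = uniform_steps[of n]
  have f: "feasible n ?c"
    unfolding feasible_def using assms by (auto simp: st)
  let ?z = "shift_at n 1 1 (- 2 / n) ?c"
  have p: "2 * 1 < n" "(1::nat) \<ge> 1" "1 \<in> {1..n - 1}" using assms by auto
  have "ht_corner n ?z" using ht_corner_shift_at[OF c] assms by auto
  moreover have "row_sum ?z 1 1 < 0"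
    using shift_at_steps(1)[OF p, of "- 2 / n" ?c] assms st(1)[of 1 1] by (simp add: divide_less_0_iff)
  moreover have "feasible_except n ?z {(1, 1), (n, n - 1)} {(1, 1), (n - 1, n)}"
  proof (rule feasible_except_shift_at[OF c f p])
    show "row_sum ?c (1 + 1) 1 - (- 2 / n) \<in> {0..1}"
      using assms by (subst st(1)) (auto simp: field_simps)
    show "col_sum ?c 1 (1 + 1) - (- 2 / n) \<in> {0..1}"
      using assms by (subst st(2)) (auto simp: field_simps)
  qed (use assms in auto)
  ultimately show ?thesis by (rule that)
qed

text \<open>The shift sits just above the central row, which the half-turn maps to itself. For
  \<open>j = k\<close> the step in the central column at row \<open>k\<close> equals the violated
  sum and must be exempted; its image at row \<open>k + 1\<close> is exempted with it, and neither
  is an \<open>N\<close> equation.\<close>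

lemma odd_center_witness_frame:
  assumes "odd n" "n \<ge> 4" and j: "1 \<le> j" "j \<le> n div 2"
  defines "k \<equiv> n div 2"
  assumes c: "ht_corner n c" "feasible n c"
    and steps: "row_sum c k j + t \<in> {0..1}" "col_sum c k j + t \<in> {0..1}"
      "j < k \<Longrightarrow> col_sum c k (j + 1) - t \<in> {0..1}"
  shows "ht_corner n (shift_at n k j t c)" "row_sum (shift_at n k j t c) (k + 1) j = row_sum c (k + 1) j - t"
    "feasible_except n (shift_at n k j t c) {(k + 1, j), (k + 1, n - j)}
       (if j = k then {(k, k + 1), (k + 1, k + 1)} else {})"
proof -
  have n: "n = 2 * k + 1" "k \<ge> 2" using assms(1,2) by (auto simp: k_def)
  have p: "2 * k < n" "k \<ge> 1" "j \<in> {1..n - 1}" using n j by (auto simp: k_def[symmetric])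
  have jk: "j \<le> k" using j by (simp add: k_def)
  show "ht_corner n (shift_at n k j t c)"
    using ht_corner_shift_at[OF c(1)] p by auto
  show "row_sum (shift_at n k j t c) (k + 1) j = row_sum c (k + 1) j - t"
    by (rule shift_at_steps(2)[OF p])
  show "feasible_except n (shift_at n k j t c) {(k + 1, j), (k + 1, n - j)}
       (if j = k then {(k, k + 1), (k + 1, k + 1)} else {})"
    by (rule feasible_except_shift_at[OF c p]) (use n jk steps in \<open>auto split: if_splits\<close>)
qed

lemma violate_center_row_lower:
  assumes "odd n" "n \<ge> 4" and j: "1 \<le> j" "j \<le> n div 2"
  defines "k \<equiv> n div 2"
  obtains z where "ht_corner n z" "row_sum z (k + 1) j < 0"
    "feasible_except n z {(k + 1, j), (k + 1, n - j)} (if j = k then {(k, k + 1), (k + 1, k + 1)} else {})"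
proof -
  have n: "n = 2 * k + 1" "k \<ge> 2" using assms(1,2) by (auto simp: k_def)
  have jk: "j \<le> k" using j by (simp add: k_def)
  \<comment> \<open>The number of non-central rows, or columns, among the first \<open>u\<close>;
    there are \<open>2 * k\<close> of them in total.\<close>
  define g where "g u = real u - of_bool (k < u)" for u
  text \<open>The central entry is 1, the other entries of the central row and column vanish, and all
    remaining entries are equal.\<close>
  define c where "c u v = g u * g v / (2 * k) + of_bool (k < u \<and> k < v)" for u v
  have g_rot: "g (n - u) = 2 * k - g u" if "u \<le> n" for u
    using that n by (auto simp: g_def of_nat_diff)
  have g_diff: "g u - g (u - 1) = (if u = k + 1 then 0 else 1)" if "1 \<le> u" for u
    using that by (auto simp: g_def of_nat_diff)
  have g_range: "0 \<le> g u" "g u \<le> 2 * k" if "u \<le> n" for u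
    using that n by (auto simp: g_def)
  have "c (n - u) (n - v) = real n - real u - real v + c u v" if uv: "u \<le> n" "v \<le> n" for u v
  proof -
    have "c (n - u) (n - v) = (2 * k - g u) * (2 * k - g v) / (2 * k) + of_bool (k < n - u \<and> k < n - v)"
      by (simp add: c_def g_rot[OF uv(1)] g_rot[OF uv(2)])
    also have "(2 * k - g u) * (2 * k - g v) / (2 * k) = 2 * k - g u - g v + g u * g v / (2 * k)"
      using n by (simp add: field_simps)
    finally show ?thesis using uv n by (auto simp: c_def g_def)
  qed
  moreover have g0: "g 0 = 0" "g n = 2 * k" using n by (auto simp: g_def)
  ultimately have c: "ht_corner n c"
    using n(2) by (auto simp: ht_corner_def c_def g0 g_def)
  have row: "row_sum c u v = (if u = k + 1 then of_bool (k < v) else g v / (2 * k))" if "1 \<le> u" for u v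
  proof -
    have "row_sum c u v = (g u - g (u - 1)) * g v / (2 * k) + (of_bool (k < u \<and> k < v) - of_bool (k < u - 1 \<and> k < v))"
      by (simp add: row_sum_def c_def diff_divide_distrib left_diff_distrib)
    then show ?thesis using g_diff[OF that] by auto
  qed
  have col: "col_sum c u v = (if v = k + 1 then of_bool (k < u) else g u / (2 * k))" if "1 \<le> v" for u v
  proof -
    have "col_sum c u v = g u * (g v - g (v - 1)) / (2 * k) + (of_bool (k < u \<and> k < v) - of_bool (k < u \<and> k < v - 1))"
      by (simp add: col_sum_def c_def diff_divide_distrib right_diff_distrib)
    then show ?thesis using g_diff[OF that] by auto
  qed
  have f: "feasible n c"
    unfolding feasible_def using row col g_range n by auto
  have gk: "g k = k" "g j = j" using jk by (simp_all add: g_def)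
  \<comment> \<open>Above the central row a non-central column has collected
    \<open>k / (2 * k) = 1/2\<close>, so a shift by 1/2 just fills column \<open>j\<close> and, for
    \<open>j < k\<close>, just empties column \<open>j + 1\<close>. The sum in row \<open>k\<close>
    is at most 1/2 because \<open>j \<le> k\<close>.\<close>
  have *: "row_sum c k j + 1/2 \<in> {0..1}" "col_sum c k j + 1/2 \<in> {0..1}"
    "j < k \<Longrightarrow> col_sum c k (j + 1) - 1/2 \<in> {0..1}"
  proof -
    have "0 \<le> real j / (2 * k)" "real j / (2 * k) \<le> 1/2" using jk n(2) by (simp_all add: field_simps)
    moreover have "row_sum c k j = real j / (2 * k)" using row[of k j] n(2) by (simp add: gk)
    ultimately show "row_sum c k j + 1/2 \<in> {0..1}" unfolding atLeastAtMost_iff by linarith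
    show "col_sum c k j + 1/2 \<in> {0..1}" using col[of j k] n(2) j jk by (simp add: gk)
    show "col_sum c k (j + 1) - 1/2 \<in> {0..1}" if "j < k" using col[of "j + 1" k] n(2) that by (simp add: gk)
  qed
  note frame = odd_center_witness_frame[OF assms(1,2) j c f, folded k_def, OF *]
  have "row_sum c (k + 1) j = 0" using row[of "k + 1" j] jk by simp
  with frame(2) have "row_sum (shift_at n k j (1/2) c) (k + 1) j < 0" by simp
  from that[OF frame(1) this frame(3)] show ?thesis .
qed

text \<open>Reflection cannot reduce this to the lower bound: in the central row, reflection
  followed by the half-turn identity sends a negative sum at \<open>j\<close> back to a negative sum
  at \<open>j\<close>. The starting point must instead have central partial sums equal to 1.\<close>

lemma violate_center_row_upper:
  assumes "odd n" "n \<ge> 4" and j: "2 \<le> j" "j \<le> n div 2"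
  defines "k \<equiv> n div 2"
  obtains z where "ht_corner n z" "row_sum z (k + 1) j > 1"
    "feasible_except n z {(k + 1, j), (k + 1, n - j)} (if j = k then {(k, k + 1), (k + 1, k + 1)} else {})"
proof -
  have n: "n = 2 * k + 1" "k \<ge> 2" using assms(1,2) by (auto simp: k_def)
  have jk: "j \<le> k" using j by (simp add: k_def)
  define g where "g u = real u - of_bool (k < u)" for u
  \<comment> \<open>For \<open>1 \<le> v < n\<close>, \<open>w v\<close> is \<open>2 * k\<close>
    times the sum of the first \<open>v\<close> entries of a non-central row. Such a row is 0 at
    both ends and has double weight in the central column, to offset the ends 1 and the centre -1 of
    the central row.\<close>
  define w where "w v = real v - of_bool (v \<le> k)" for v
  text \<open>The central row is 1 at both ends and -1 in the center, and the other rows are equal.\<close>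
  define c where "c u v = (if v = 0 then 0 else if v = n then real u
      else g u * w v / (2 * k) + of_bool (k < u \<and> v \<le> k))" for u v
  have g_rot: "g (n - u) = 2 * k - g u" if "u \<le> n" for u
    using that n by (auto simp: g_def of_nat_diff)
  have w_rot: "w (n - v) = 2 * k - w v" if "v \<le> n" for v
    using that n by (auto simp: w_def of_nat_diff)
  have g_diff: "g u - g (u - 1) = (if u = k + 1 then 0 else 1)" if "1 \<le> u" for u
    using that by (auto simp: g_def of_nat_diff)
  have w_diff: "w v - w (v - 1) = (if v = k + 1 then 2 else 1)" if "1 \<le> v" for v
    using that by (auto simp: w_def of_nat_diff)
  have g_range: "0 \<le> g u" "g u \<le> 2 * k" if "u \<le> n" for u
    using that n by (auto simp: g_def)
  have w_range: "0 \<le> w v" "w v \<le> 2 * k" if "1 \<le> v" "v < n" for v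
    using that n by (auto simp: w_def)
  have "c (n - u) (n - v) = real n - real u - real v + c u v" if uv: "u \<le> n" "v \<le> n" for u v
  proof -
    consider "v = 0" | "v = n" | "1 \<le> v" "v < n" using uv by linarith
    then show ?thesis
    proof cases
      case 3
      then have "n - v \<noteq> 0" "n - v \<noteq> n" by auto
      then have "c (n - u) (n - v) = (2 * k - g u) * (2 * k - w v) / (2 * k) + of_bool (k < n - u \<and> n - v \<le> k)"
        by (simp add: c_def g_rot[OF uv(1)] w_rot[OF uv(2)])
      also have "(2 * k - g u) * (2 * k - w v) / (2 * k) = 2 * k - g u - w v + g u * w v / (2 * k)"
        using n by (simp add: field_simps)
      finally show ?thesis using uv n 3 by (auto simp: c_def g_def w_def)
    qed (use uv n in \<open>auto simp: c_def of_nat_diff\<close>)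
  qed
  moreover have g0: "g 0 = 0" "g n = 2 * k" using n by (auto simp: g_def)
  moreover have "c 0 u = 0 \<and> c n u = real u" if "u \<le> n" for u
  proof -
    have "k < n" "n \<noteq> 0" "real k \<noteq> 0" using n by auto
    then show ?thesis by (auto simp: c_def g0 w_def)
  qed
  ultimately have c: "ht_corner n c"
    using n(2) by (auto simp: ht_corner_def c_def)
  have row: "row_sum c u v = (if u = k + 1 then of_bool (v \<le> k) else w v / (2 * k))"
    if "1 \<le> u" "1 \<le> v" "v < n" for u v
  proof -
    have "row_sum c u v = (g u - g (u - 1)) * w v / (2 * k) + (of_bool (k < u \<and> v \<le> k) - of_bool (k < u - 1 \<and> v \<le> k))"
      using that by (simp add: row_sum_def c_def diff_divide_distrib left_diff_distrib)
    then show ?thesis using g_diff[OF that(1)] by auto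
  qed
  have col: "col_sum c u v = (if v = 1 \<or> v = n then of_bool (k < u)
      else if v = k + 1 then g u / k - of_bool (k < u) else g u / (2 * k))" if v: "1 \<le> v" "v \<le> n" for u v
  proof -
    consider "v = 1" | "v = n" | "2 \<le> v" "v < n" using v by linarith
    then show ?thesis
    proof cases
      case 1
      then show ?thesis using n by (simp add: col_sum_def c_def w_def)
    next
      case 2
      have "n - 1 \<noteq> 0" "n - 1 \<noteq> n" "w (n - 1) = 2 * k" "\<not> n - 1 \<le> k" using n by (auto simp: w_def)
      then have "c u (n - 1) = g u" using n(2) by (simp add: c_def)
      moreover have "c u n = real u" using n by (simp add: c_def)
      ultimately show ?thesis using 2 by (simp add: col_sum_def g_def)
    next
      case 3
      have "col_sum c u v = g u * (w v - w (v - 1)) / (2 * k) + (of_bool (k < u \<and> v \<le> k) - of_bool (k < u \<and> v - 1 \<le> k))"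
      proof -
        have "v \<noteq> 0" "v \<noteq> n" "v - 1 \<noteq> 0" "v - 1 \<noteq> n" using 3 by auto
        then show ?thesis by (simp add: col_sum_def c_def diff_divide_distrib right_diff_distrib)
      qed
      then show ?thesis using w_diff[OF that(1)] 3 by auto
    qed
  qed
  have g_center: "g u / k - of_bool (k < u) \<in> {0..1}" if "u \<le> n" for u
    using that n by (auto simp: g_def field_simps)
  have f: "feasible n c"
    unfolding feasible_def
  proof (intro conjI ballI allI impI)
    fix u v assume uv: "u \<in> {1..n}" "v \<le> n"
    then consider "v = 0" | "v = n" | "1 \<le> v" "v < n" by fastforce
    then show "row_sum c u v \<in> {0..1}"
    proof cases
      case 3
      then show ?thesis using row[of u v] w_range[of v] uv n by auto
    qed (use row_sum_trivial[OF c] uv in auto)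
  next
    fix u v assume "u \<le> n" "v \<in> {1..n}"
    then show "col_sum c u v \<in> {0..1}" using col[of v u] g_range[of u] g_center[of u] n by auto
  qed
  have gk: "g k = k" "w j = real j - 1" using jk by (simp_all add: g_def w_def)
  have jk': "2 \<le> real j" "real j \<le> real k" using j jk by simp_all
  \<comment> \<open>The negative shift raises the central sum above 1 and lowers the sum in row
    \<open>k\<close> from \<open>(j - 1) / (2 * k)\<close> to \<open>(j - 2) / (2 * k)\<close>,
    which is why \<open>2 \<le> j\<close> is assumed. The affected non-central column sums start at
    1/2 and have room.\<close>
  have *: "row_sum c k j + - (1 / (2 * k)) \<in> {0..1}" "col_sum c k j + - (1 / (2 * k)) \<in> {0..1}"
    "j < k \<Longrightarrow> col_sum c k (j + 1) - - (1 / (2 * k)) \<in> {0..1}"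
  proof -
    have eq: "row_sum c k j = (real j - 1) / (2 * k)" "col_sum c k j = 1/2"
      using row[of k j] col[of j k] n j jk by (simp_all add: gk)
    have "0 \<le> (real j - 2) / (2 * k)" "(real j - 2) / (2 * k) \<le> 1"
      using jk' n(2) by (simp_all add: field_simps)
    then show "row_sum c k j + - (1 / (2 * k)) \<in> {0..1}"
      unfolding eq by (simp add: diff_divide_distrib)
    have half: "0 \<le> 1 / (2 * real k)" "1 / (2 * real k) \<le> 1/2" using n(2) by (simp_all add: field_simps)
    then show "col_sum c k j + - (1 / (2 * k)) \<in> {0..1}" unfolding eq atLeastAtMost_iff by linarith
    show "col_sum c k (j + 1) - - (1 / (2 * k)) \<in> {0..1}" if "j < k"
    proof -
      have "col_sum c k (j + 1) = 1/2" using col[of "j + 1" k] n j that by (simp add: gk)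
      then show ?thesis using half unfolding atLeastAtMost_iff by linarith
    qed
  qed
  have j1: "1 \<le> j" using j by simp
  note frame = odd_center_witness_frame[OF assms(1,2) j1 j(2) c f, folded k_def, OF *]
  have "row_sum c (k + 1) j = 1" using row[of "k + 1" j] j jk n by simp
  with frame(2) n have "row_sum (shift_at n k j (- (1 / (2 * k))) c) (k + 1) j > 1" by simp
  from that[OF frame(1) this frame(3)] show ?thesis .
qed

subsection \<open>Facets of the core polytope\<close>

text \<open>With \<open>m = n - 2\<close>, the \<open>R\<close> and \<open>K\<close> equations
  number \<open>2 + 4 * (k - 1) * m\<close>. For even \<open>n\<close>,
  \<open>m = 2 * (k - 1)\<close> and this is twice \<open>m * m + 1\<close>. For odd
  \<open>n\<close>, the \<open>4 * (k - 1)\<close> central equations give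
  \<open>2 + 4 * (k - 1) * (m + 1)\<close>, and \<open>m - 1 = 2 * (k - 1)\<close> turns this into
  twice \<open>m * m\<close>.\<close>

lemma card_facet_equations:
  assumes "n \<ge> 4"
  shows "card (facet_equations n) = 2 * ((n - 2)\<^sup>2 + of_bool (even n))"
proof -
  define k where "k = n div 2"
  define m where "m = n - 2"
  have k: "k \<ge> 2" using assms by (auto simp: k_def)
  define P where "P = {(R i j, 0::real) | i j. (i, j) \<in> {(1, 1)} \<union> {2..k} \<times> {1..n - 2}} \<union>
     {(R i j, 1) | i j. (i, j) \<in> {(1, n - 1)} \<union> {2..k} \<times> {2..n - 1}}"
  define Q where "Q = {(K i j, 0::real) | i j. (i, j) \<in> {1..n - 2} \<times> {2..k}} \<union>
     {(K i j, 1) | i j. (i, j) \<in> {2..n - 1} \<times> {2..k}}"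
  define U where "U = {(M j, 0::real) | j. j \<in> {1..k}} \<union> {(M j, 1) | j. j \<in> {2..k}}"
  define V where "V = {(N i, 0::real) | i. i \<in> {1..k - 1}} \<union> {(N i, 1) | i. i \<in> {2..k - 1}}"
  have card_Un: "finite (X \<union> Y) \<and> card (X \<union> Y) = a + b"
    if "finite X \<and> card X = a" "finite Y \<and> card Y = b" "X \<inter> Y = {}"
    for X Y :: "(partial_sum \<times> real) set" and a b
    using that by (simp add: card_Un_disjoint)
  have img: "finite (f ` X) \<and> card (f ` X) = a" if "inj_on f X" "finite X" "card X = a"
    for f :: "'x \<Rightarrow> partial_sum \<times> real" and X a
    using that by (simp add: card_image)
  have P: "finite P \<and> card P = (1 + (k - 1) * m) + (1 + (k - 1) * m)"
  proof -
    have "P = (\<lambda>(i, j). (R i j, 0)) ` ({(1, 1)} \<union> {2..k} \<times> {1..n - 2}) \<union>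
        (\<lambda>(i, j). (R i j, 1)) ` ({(1, n - 1)} \<union> {2..k} \<times> {2..n - 1})"
      unfolding P_def by (intro arg_cong2[of _ _ _ _ "(\<union>)"]) (force simp: image_iff)+
    also have "finite \<dots> \<and> card \<dots> = (1 + (k - 1) * m) + (1 + (k - 1) * m)"
      by (intro card_Un img) (auto simp: inj_on_def m_def card_cartesian_product card_insert_if)
    finally show ?thesis .
  qed
  have Q: "finite Q \<and> card Q = (k - 1) * m + (k - 1) * m"
  proof -
    have "Q = (\<lambda>(i, j). (K i j, 0)) ` ({1..n - 2} \<times> {2..k}) \<union> (\<lambda>(i, j). (K i j, 1)) ` ({2..n - 1} \<times> {2..k})"
      unfolding Q_def by (intro arg_cong2[of _ _ _ _ "(\<union>)"]) (force simp: image_iff)+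
    also have "finite \<dots> \<and> card \<dots> = (k - 1) * m + (k - 1) * m"
      by (intro card_Un img) (auto simp: inj_on_def m_def card_cartesian_product)
    finally show ?thesis .
  qed
  have U: "finite U \<and> card U = k + (k - 1)"
  proof -
    have "U = (\<lambda>j. (M j, 0)) ` {1..k} \<union> (\<lambda>j. (M j, 1)) ` {2..k}"
      unfolding U_def by (intro arg_cong2[of _ _ _ _ "(\<union>)"]) (force simp: image_iff)+
    also have "finite \<dots> \<and> card \<dots> = k + (k - 1)"
      by (intro card_Un img) (auto simp: inj_on_def)
    finally show ?thesis .
  qed
  have V: "finite V \<and> card V = (k - 1) + (k - 2)"
  proof -
    have "V = (\<lambda>i. (N i, 0)) ` {1..k - 1} \<union> (\<lambda>i. (N i, 1)) ` {2..k - 1}"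
      unfolding V_def by (intro arg_cong2[of _ _ _ _ "(\<union>)"]) (force simp: image_iff)+
    also have "finite \<dots> \<and> card \<dots> = (k - 1) + (k - 2)"
      by (intro card_Un img) (auto simp: inj_on_def)
    finally show ?thesis .
  qed
  have PQ: "finite (P \<union> Q) \<and> card (P \<union> Q) = 2 + 4 * (k - 1) * m"
    using card_Un[OF P Q] by (force simp: P_def Q_def)
  show ?thesis
  proof (cases "even n")
    case True
    then have "facet_equations n = P \<union> Q"
      unfolding facet_equations_def P_def Q_def k_def[symmetric] Let_def by auto
    moreover have "m = 2 * (k - 1)" using True by (auto simp: m_def k_def elim!: evenE)
    ultimately show ?thesis using True PQ by (simp add: m_def[symmetric] power2_eq_square)
  next
    case False
    then have n: "n = 2 * k + 1" by (simp add: k_def)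
    have UV: "finite (U \<union> V) \<and> card (U \<union> V) = 4 * (k - 1)"
      using card_Un[OF U V] k by (force simp: U_def V_def)
    have "facet_equations n = (P \<union> Q) \<union> (U \<union> V)"
      unfolding facet_equations_def P_def Q_def U_def V_def k_def[symmetric] Let_def using False by auto
    moreover have "card ((P \<union> Q) \<union> (U \<union> V)) = 2 + 4 * (k - 1) * m + 4 * (k - 1)"
      using card_Un[OF PQ UV] by (force simp: P_def Q_def U_def V_def)
    moreover obtain k' where "k = Suc k'" using k by (cases k) auto
    ultimately show ?thesis using False n by (simp add: m_def power2_eq_square algebra_simps)
  qed
qed

fun touches :: "nat \<Rightarrow> (nat \<times> nat) set \<Rightarrow> (nat \<times> nat) set \<Rightarrow> partial_sum \<Rightarrow> bool" where
  "touches n S T (R i j) \<longleftrightarrow> (i, j) \<in> S"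
| "touches n S T (K i j) \<longleftrightarrow> (i, j) \<in> T"
| "touches n S T (M j) \<longleftrightarrow> ((n + 1) div 2, j) \<in> S"
| "touches n S T (N i) \<longleftrightarrow> (i, (n + 1) div 2) \<in> T"

lemma feasible_except_corner_value:
  assumes "feasible_except n c S T" "e \<in> facet_equations n" "n \<ge> 4" "\<not> touches n S T (fst e)"
  shows "corner_value n c (fst e) \<in> {0..1}"
proof -
  have row: "row_sum c i j \<in> {0..1}" if "1 \<le> i" "i \<le> n" "j \<le> n" "(i, j) \<notin> S" for i j
    using assms(1) that by (simp add: feasible_except_def)
  have col: "col_sum c i j \<in> {0..1}" if "i \<le> n" "1 \<le> j" "j \<le> n" "(i, j) \<notin> T" for i j
    using assms(1) that by (simp add: feasible_except_def)
  from assms(2) show ?thesis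
    by (cases rule: facet_equationsE) (use assms(3,4) in \<open>simp_all add: row col del: atLeastAtMost_iff\<close>)
qed

section \<open>Irredundancy of the listed inequalities and the facet bijection\<close>

context htsasm_core
begin

text \<open>The opposite bound on the violated sum holds automatically, since a negative number is
  at most 1 and a number above 1 is nonnegative. It remains that no other listed sum lies at an
  exempt position.\<close>

lemma separating_point:
  assumes e: "(L, b) \<in> facet_equations n" and z: "ht_corner n z" "feasible_except n z S T"
    and viol: "b = 0 \<Longrightarrow> corner_value n z L < 0" "b = 1 \<Longrightarrow> corner_value n z L > 1"
    and other: "\<And>L' b'. (L', b') \<in> facet_equations n \<Longrightarrow> L' \<noteq> L \<Longrightarrow> \<not> touches n S T L'"
  shows "\<exists>y\<in>corner_space. signed_sum n idx (L, b) y > snd (L, b) \<and>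
    (\<forall>e'\<in>facet_equations n - {(L, b)}. signed_sum n idx e' y \<le> snd e')"
proof (intro bexI[of _ "core_point z"] conjI ballI)
  show "core_point z \<in> corner_space" using z by (simp add: corner_space_def)
  show "signed_sum n idx (L, b) (core_point z) > snd (L, b)"
    using facet_inequality_iff[OF z(1) e] viol by auto
  fix e' assume e': "e' \<in> facet_equations n - {(L, b)}"
  obtain L' b' where Lb: "e' = (L', b')" by fastforce
  then have mem: "(L', b') \<in> facet_equations n" using e' by simp
  show "signed_sum n idx e' (core_point z) \<le> snd e'"
  proof (cases "L' = L")
    case True
    then have "b' \<noteq> b" using e' Lb by auto
    then show ?thesis
      using facet_inequality_iff[OF z(1) mem] facet_inequality_iff[OF z(1) e] viol True Lb by auto
  next
    case False
    then have "corner_value n z L' \<in> {0..1}"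
      using feasible_except_corner_value[OF z(2) mem n4] other[OF mem] by simp
    then show ?thesis
      using facet_inequality_iff[OF z(1) mem] Lb by auto
  qed
qed

lemma facet_inequality_irredundant:
  assumes e: "e \<in> facet_equations n"
  shows "\<exists>y\<in>corner_space. signed_sum n idx e y > snd e \<and>
    (\<forall>e'\<in>facet_equations n - {e}. signed_sum n idx e' y \<le> snd e')"
proof -
  \<comment> \<open>These facts place the half-turn images of exempt positions beyond the upper or
    left half and off the centre, outside the range of the listed sums.\<close>
  have mid: "Suc n - x \<noteq> Suc (n div 2)" "Suc (n div 2) \<noteq> Suc n - x"
    if "x \<le> n div 2" "odd n" for x
    using that by presburger+
  have low: "\<not> Suc n - x \<le> n div 2" if "x \<le> n div 2" for x
    using that by presburger
  from e show ?thesis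
  proof (cases rule: facet_equationsE)
    case (R0 i j)
    obtain z where z: "ht_corner n z" and viol: "row_sum z i j < 0"
      and f: "feasible_except n z {(i, j), (n + 1 - i, n - j)} {}"
      using violate_row_lower[of i n j] R0 by blast
    show ?thesis unfolding R0(1)
    proof (rule separating_point[OF _ z f])
      show "(R i j, 0) \<in> facet_equations n" using e R0(1) by simp
      show "\<not> touches n {(i, j), (n + 1 - i, n - j)} {} L'"
        if "(L', b') \<in> facet_equations n" "L' \<noteq> R i j" for L' b'
        using that R0 n4 by (cases L') (auto simp: mem_facet_equations mid low)
    qed (use viol in simp_all)
  next
    case R0'
    obtain z where z: "ht_corner n z" and viol: "row_sum z 1 1 < 0"
      and f: "feasible_except n z {(1, 1), (n, n - 1)} {(1, 1), (n - 1, n)}"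
      using violate_corner_entry[of n] n4 by blast
    show ?thesis unfolding R0'
    proof (rule separating_point[OF _ z f])
      show "(R 1 1, 0) \<in> facet_equations n" using e R0' by simp
      show "\<not> touches n {(1, 1), (n, n - 1)} {(1, 1), (n - 1, n)} L'"
        if "(L', b') \<in> facet_equations n" "L' \<noteq> R 1 1" for L' b'
        using that R0' n4 by (cases L') (auto simp: mem_facet_equations mid low)
    qed (use viol in simp_all)
  next
    case (R1 i j)
    then have "1 \<le> n - j" "n - j \<le> n - 2" by auto
    then obtain z where z: "ht_corner n z" and neg: "row_sum z i (n - j) < 0"
      and f: "feasible_except n z {(i, n - j), (n + 1 - i, n - (n - j))} {}"
      using violate_row_lower[of i n "n - j"] R1 by blast
    have viol: "row_sum (reflect n z) i j > 1"
      using neg R1 by (simp add: row_sum_reflect)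
    show ?thesis unfolding R1(1)
    proof (rule separating_point[OF _ ht_corner_reflect[OF z] feasible_except_reflect[OF f]])
      show "(R i j, 1) \<in> facet_equations n" using e R1(1) by simp
      show "\<not> touches n {(i', j'). (i', n - j') \<in> {(i, n - j), (n + 1 - i, n - (n - j))}} {(i', j'). (i', n + 1 - j') \<in> {}} L'"
        if "(L', b') \<in> facet_equations n" "L' \<noteq> R i j" for L' b'
        using that R1 n4 by (cases L') (auto simp: mem_facet_equations mid low)
    qed (use viol in simp_all)
  next
    case R1'
    obtain z where z: "ht_corner n z" and neg: "row_sum z 1 1 < 0"
      and f: "feasible_except n z {(1, 1), (n, n - 1)} {(1, 1), (n - 1, n)}"
      using violate_corner_entry[of n] n4 by blast
    have viol: "row_sum (reflect n z) 1 (n - 1) > 1"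
      using neg n4 by (simp add: row_sum_reflect)
    show ?thesis unfolding R1'
    proof (rule separating_point[OF _ ht_corner_reflect[OF z] feasible_except_reflect[OF f]])
      show "(R 1 (n - 1), 1) \<in> facet_equations n" using e R1' by simp
      show "\<not> touches n {(i', j'). (i', n - j') \<in> {(1, 1), (n, n - 1)}} {(i', j'). (i', n + 1 - j') \<in> {(1, 1), (n - 1, n)}} L'"
        if "(L', b') \<in> facet_equations n" "L' \<noteq> R 1 (n - 1)" for L' b'
        using that R1' n4 by (cases L') (auto simp: mem_facet_equations mid low)
    qed (use viol in simp_all)
  next
    case (K0 i j)
    obtain z where z: "ht_corner n z" and neg: "row_sum z j i < 0"
      and f: "feasible_except n z {(j, i), (n + 1 - j, n - i)} {}"
      using violate_row_lower[of j n i] K0 by blast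
    have viol: "col_sum (\<lambda>u v. z v u) i j < 0"
      using neg by (simp add: col_sum_def row_sum_def)
    show ?thesis unfolding K0(1)
    proof (rule separating_point[OF _ ht_corner_transpose[OF z] feasible_except_transpose[OF f]])
      show "(K i j, 0) \<in> facet_equations n" using e K0(1) by simp
      show "\<not> touches n {(i', j'). (j', i') \<in> {}} {(i', j'). (j', i') \<in> {(j, i), (n + 1 - j, n - i)}} L'"
        if "(L', b') \<in> facet_equations n" "L' \<noteq> K i j" for L' b'
        using that K0 n4 by (cases L') (auto simp: mem_facet_equations mid low)
    qed (use viol in simp_all)
  next
    case (K1 i j)
    then have "1 \<le> n - i" "n - i \<le> n - 2" by auto
    then obtain z where z: "ht_corner n z" and neg: "row_sum z j (n - i) < 0"
      and f: "feasible_except n z {(j, n - i), (n + 1 - j, n - (n - i))} {}"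
      using violate_row_lower[of j n "n - i"] K1 by blast
    have "row_sum (reflect n z) j i > 1"
      using neg K1 by (simp add: row_sum_reflect)
    then have viol: "col_sum (\<lambda>u v. reflect n z v u) i j > 1"
      by (simp add: col_sum_def row_sum_def)
    show ?thesis unfolding K1(1)
    proof (rule separating_point[OF _ ht_corner_transpose[OF ht_corner_reflect[OF z]] feasible_except_transpose[OF feasible_except_reflect[OF f]]])
      show "(K i j, 1) \<in> facet_equations n" using e K1(1) by simp
      show "\<not> touches n {(i', j'). (j', i') \<in> {(i', j'). (i', n + 1 - j') \<in> {}}} {(i', j'). (j', i') \<in> {(i', j'). (i', n - j') \<in> {(j, n - i), (n + 1 - j, n - (n - i))}}} L'"
        if "(L', b') \<in> facet_equations n" "L' \<noteq> K i j" for L' b'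
        using that K1 n4 by (cases L') (auto simp: mem_facet_equations mid low)
    qed (use viol in simp_all)
  next
    case (M0 j)
    have half: "(n + 1) div 2 = n div 2 + 1" using M0(1) by simp
    obtain z where z: "ht_corner n z" and viol: "row_sum z ((n + 1) div 2) j < 0"
      and f: "feasible_except n z {(n div 2 + 1, j), (n div 2 + 1, n - j)}
        (if j = n div 2 then {(n div 2, n div 2 + 1), (n div 2 + 1, n div 2 + 1)} else {})"
      using violate_center_row_lower[of n j] M0 n4 half by metis
    show ?thesis unfolding M0(2)
    proof (rule separating_point[OF _ z f])
      show "(M j, 0) \<in> facet_equations n" using e M0(2) by simp
      show "\<not> touches n {(n div 2 + 1, j), (n div 2 + 1, n - j)} (if j = n div 2 then {(n div 2, n div 2 + 1), (n div 2 + 1, n div 2 + 1)} else {}) L'"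
        if "(L', b') \<in> facet_equations n" "L' \<noteq> M j" for L' b'
        using that M0 n4 by (cases L') (auto simp: mem_facet_equations mid low split: if_splits)
    qed (use viol in simp_all)
  next
    case (M1 j)
    have half: "(n + 1) div 2 = n div 2 + 1" using M1(1) by simp
    obtain z where z: "ht_corner n z" and viol: "row_sum z ((n + 1) div 2) j > 1"
      and f: "feasible_except n z {(n div 2 + 1, j), (n div 2 + 1, n - j)}
        (if j = n div 2 then {(n div 2, n div 2 + 1), (n div 2 + 1, n div 2 + 1)} else {})"
      using violate_center_row_upper[of n j] M1 n4 half by metis
    show ?thesis unfolding M1(2)
    proof (rule separating_point[OF _ z f])
      show "(M j, 1) \<in> facet_equations n" using e M1(2) by simp
      show "\<not> touches n {(n div 2 + 1, j), (n div 2 + 1, n - j)} (if j = n div 2 then {(n div 2, n div 2 + 1), (n div 2 + 1, n div 2 + 1)} else {}) L'"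
        if "(L', b') \<in> facet_equations n" "L' \<noteq> M j" for L' b'
        using that M1 n4 by (cases L') (auto simp: mem_facet_equations mid low split: if_splits)
    qed (use viol in simp_all)
  next
    case (N0 i)
    have half: "(n + 1) div 2 = n div 2 + 1" using N0(1) by simp
    \<comment> \<open>Strictly before the middle the central-row witness exempts no column sums, so
      its transpose exempts no row sums and in particular touches no \<open>M\<close>.\<close>
    have ik: "i \<le> n div 2" "i \<noteq> n div 2" using N0 n4 by auto
    obtain z where z: "ht_corner n z" and sum: "row_sum z (n div 2 + 1) i < 0"
      and f: "feasible_except n z {(n div 2 + 1, i), (n div 2 + 1, n - i)} {}"
      using violate_center_row_lower[of n i, unfolded if_not_P[OF ik(2)]] N0 n4 ik by blast
    have viol: "col_sum (\<lambda>u v. z v u) i ((n + 1) div 2) < 0"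
      using sum unfolding half by (simp add: col_sum_def row_sum_def)
    show ?thesis unfolding N0(2)
    proof (rule separating_point[OF _ ht_corner_transpose[OF z] feasible_except_transpose[OF f]])
      show "(N i, 0) \<in> facet_equations n" using e N0(2) by simp
      show "\<not> touches n {(i', j'). (j', i') \<in> {}} {(i', j'). (j', i') \<in> {(n div 2 + 1, i), (n div 2 + 1, n - i)}} L'"
        if "(L', b') \<in> facet_equations n" "L' \<noteq> N i" for L' b'
        using that N0 n4 by (cases L') (auto simp: mem_facet_equations mid low)
    qed (use viol in simp_all)
  next
    case (N1 i)
    have half: "(n + 1) div 2 = n div 2 + 1" using N1(1) by simp
    have ik: "i \<le> n div 2" "i \<noteq> n div 2" using N1 n4 by auto
    obtain z where z: "ht_corner n z" and sum: "row_sum z (n div 2 + 1) i > 1"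
      and f: "feasible_except n z {(n div 2 + 1, i), (n div 2 + 1, n - i)} {}"
      using violate_center_row_upper[of n i, unfolded if_not_P[OF ik(2)]] N1 n4 ik by blast
    have viol: "col_sum (\<lambda>u v. z v u) i ((n + 1) div 2) > 1"
      using sum unfolding half by (simp add: col_sum_def row_sum_def)
    show ?thesis unfolding N1(2)
    proof (rule separating_point[OF _ ht_corner_transpose[OF z] feasible_except_transpose[OF f]])
      show "(N i, 1) \<in> facet_equations n" using e N1(2) by simp
      show "\<not> touches n {(i', j'). (j', i') \<in> {}} {(i', j'). (j', i') \<in> {(n div 2 + 1, i), (n div 2 + 1, n - i)}} L'"
        if "(L', b') \<in> facet_equations n" "L' \<noteq> N i" for L' b'
        using that N1 n4 by (cases L') (auto simp: mem_facet_equations mid low)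
    qed (use viol in simp_all)
  qed
qed

lemma bij_betw_sum_face:
  "bij_betw (sum_face n idx) (facet_equations n) {F. F facet_of HTSASM_core_polytope n idx}"
proof -
  let ?c = "\<lambda>u v. real u * real v / real n"
  have c: "ht_corner n ?c" using n4 ht_corner_uniform[of n] by simp
  have "bij_betw (\<lambda>e. HTSASM_core_polytope n idx \<inter> {x. signed_sum n idx e x = snd e})
      (facet_equations n) {F. F facet_of HTSASM_core_polytope n idx}"
    unfolding HTSASM_core_polytope_eq
  proof (rule bij_betw_facets_of_violated_separately[OF affine_corner_space finite_facet_equations
        linear_signed_sum facet_polyhedron_def _ _ facet_inequality_irredundant])
    show "core_point ?c \<in> corner_space" using c by (simp add: corner_space_def)
    fix e assume e: "e \<in> facet_equations n"
    obtain L b where Lb: "e = (L, b)" by fastforce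
    have "corner_value n ?c (fst e) \<in> {0<..<1}"
      using e by (cases rule: facet_equationsE) (use n4 in \<open>auto simp: uniform_steps\<close>)
    then show "signed_sum n idx e (core_point ?c) < snd e"
      using facet_inequality_iff[OF c, of L b] e Lb by auto
  qed
  \<comment> \<open>For \<open>b\<close> equal to 0 or 1, \<open>(2 * b - 1) * x = b\<close> is
    equivalent to \<open>x = b\<close>, so the sign does not change the face.\<close>
  moreover have "sum_face n idx e = HTSASM_core_polytope n idx \<inter> {x. signed_sum n idx e x = snd e}"
    if "e \<in> facet_equations n" for e
    using that by (cases rule: facet_equationsE) (auto simp: sum_face_def signed_sum_def simp del: eval_sum.simps)
  ultimately show ?thesis
    by (simp cong: bij_betw_cong)
qed

end

theorem theorem5p5:
  fixes n :: nat and idx :: "'c::finite \<Rightarrow> nat \<times> nat"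
  assumes "n \<ge> 4"
    and "bij_betw idx UNIV (core_positions n)"
  shows "bij_betw (sum_face n idx) (facet_equations n)
           {F. F facet_of HTSASM_core_polytope n idx} \<and>
         card {F. F facet_of HTSASM_core_polytope n idx} = 2 * ((n - 2)\<^sup>2 + of_bool (even n))"
proof -
  interpret htsasm_core n idx
    using assms by unfold_locales
  show ?thesis
    using bij_betw_sum_face bij_betw_same_card[OF bij_betw_sum_face] card_facet_equations[OF assms(1)]
    by simp
qed

end
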